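(* For each positive integer $n$, there exist a weighted backward shift operator $T$ (that is, the backward shift on some space $H^2_w$) that is not an $n$-hypercontraction, and a positive, bounded, real-analytic function $\psi$ defined on the unit disk $\mathbb{D}$, such that $$\partial\bar\partial\psi(w)=\mathcal{K}_{S_n^*}(w)-\mathcal{K}_T(w)\quad\text{for every } w\in\mathbb{D}.$$ Moreover, $T$ is not similar to $S_n^*$.
   Context: $\mathbb{D}$ is the open unit disk in $\mathbb{C}$; $\partial=\partial/\partial w$ and $\bar\partial=\partial/\partial\bar w$. The space $\mathcal{M}_n$ ($n\ge1$ an integer) is the Hilbert space of analytic functions $f=\sum_{k\ge0}\hat f(k)z^k$ on $\mathbb{D}$ with $\|f\|^2=\sum_{k=0}^\infty |\hat f(k)|^2\binom{n+k-1}{k}^{-1}<\infty$; its reproducing kernel is $(1-\bar w z)^{-n}$. $S_n$ is the forward shift $f(z)\mapsto zf(z)$ on $\mathcal{M}_n$ and $S_n^*$, its adjoint, is the backward shift. Weighted backward shift: for a sequence $w_j>0$ ($j\ge0$) with $\liminf_j|w_j|^{1/j}=1$ and $\sup_j w_{j+1}/w_j<\infty$, let $H^2_w=\{f=\sum_{j\ge0}a_jz^j:\ \|f\|^2=\sum_j|a_j|^2w_j<\infty\}$; the backward shift on $H^2_w$ is the adjoint of the forward shift $f(z)\mapsto zf(z)$, i.e. $T(\sum_j a_jz^j)=\sum_j\frac{w_{j+1}}{w_j}a_{j+1}z^j$. A bounded operator $T$ is an $n$-hypercontraction if $\sum_{j=0}^k(-1)^j\binom{k}{j}(T^* )^jT^j\ge0$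 for all $1\le k\le n$. Curvature: the Cowen-Douglas class $B_1(\mathbb{D})$ consists of bounded operators $T$ on a separable Hilbert space $\mathcal H$ such that $\mathbb{D}\subset\sigma(T)$, $\operatorname{ran}(T-w)$ is closed and $\dim\ker(T-w)=1$ for every $w\in\mathbb{D}$, and the closed linear span of $\bigcup_{w\in\mathbb{D}}\ker(T-w)$ is $\mathcal H$. For such $T$, the curvature is $\mathcal{K}_T(w)=-\partial\bar\partial\log\|\gamma(w)\|^2$, where $\gamma$ is a nowhere-vanishing holomorphic function on $\mathbb{D}$ with $\gamma(w)\in\ker(T-w)$ (the value does not depend on the choice of $\gamma$). In the claim, $\mathcal{K}_T$ and $\mathcal{K}_{S_n^*}$ are these curvatures. Two bounded operators $A$ on $\mathcal{H}_1$ and $B$ on $\mathcal{H}_2$ are similar if there is a bounded invertible $X:\mathcal{H}_1\to\mathcal{H}_2$ with $XA=BX$. *)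

theory Defs
  imports "HOL-Analysis.Analysis" "HOL-Library.Nonpos_Ints"
begin

section \<open>Hilbert spaces and bounded operators\<close>

text \<open>
  A Hilbert space is given by its carrier, a linear subspace of an ambient complex vector space,
  so that a whole family of spaces can live on one type. Operators are functions on the
  ambient type, of which only the restriction to the carrier matters.
  Inner products are linear in the first argument.
\<close>

record 'a hspace =
  hcar :: "'a set"
  hscale :: "complex \<Rightarrow> 'a \<Rightarrow> 'a"
  hinner :: "'a \<Rightarrow> 'a \<Rightarrow> complex"

definition hnorm :: "('a, 'b) hspace_scheme \<Rightarrow> 'a \<Rightarrow> real" where
  "hnorm H f = sqrt (Re (hinner H f f))"

text \<open>The library's metric spaces ask for nonnegativity and symmetry of the distance on the whole
  type, hence the value 0 outside the carrier.\<close>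

definition hdist :: "('a::ab_group_add, 'b) hspace_scheme \<Rightarrow> 'a \<Rightarrow> 'a \<Rightarrow> real" where
  "hdist H f g = (if f \<in> hcar H \<and> g \<in> hcar H then hnorm H (f - g) else 0)"

definition htopology :: "('a::ab_group_add, 'b) hspace_scheme \<Rightarrow> 'a topology" where
  "htopology H = Metric_space.mtopology (hcar H) (hdist H)"

definition hilbert_space :: "('a::ab_group_add, 'b) hspace_scheme \<Rightarrow> bool" where
  "hilbert_space H \<longleftrightarrow>
     vector_space (hscale H) \<and> module.subspace (hscale H) (hcar H) \<and>
     (\<forall>f\<in>hcar H. \<forall>g\<in>hcar H. hinner H g f = cnj (hinner H f g)) \<and>
     (\<forall>f\<in>hcar H. \<forall>g\<in>hcar H. \<forall>h\<in>hcar H. hinner H (f + g) h = hinner H f h + hinner H g h) \<and>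
     (\<forall>c. \<forall>f\<in>hcar H. \<forall>g\<in>hcar H. hinner H (hscale H c f) g = c * hinner H f g) \<and>
     (\<forall>f\<in>hcar H. hinner H f f \<in> \<real>\<^sub>\<ge>\<^sub>0 \<and> (hinner H f f = 0 \<longrightarrow> f = 0)) \<and>
     Metric_space.mcomplete (hcar H) (hdist H)"

definition bounded_op ::
  "('a::ab_group_add, 'c) hspace_scheme \<Rightarrow> ('b::ab_group_add, 'd) hspace_scheme \<Rightarrow> ('a \<Rightarrow> 'b) \<Rightarrow> bool" where
  "bounded_op H K X \<longleftrightarrow>
     (\<forall>f\<in>hcar H. X f \<in> hcar K) \<and>
     (\<forall>f\<in>hcar H. \<forall>g\<in>hcar H. X (f + g) = X f + X g) \<and>
     (\<forall>c. \<forall>f\<in>hcar H. X (hscale H c f) = hscale K c (X f)) \<and>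
     (\<exists>C. \<forall>f\<in>hcar H. hnorm K (X f) \<le> C * hnorm H f)"

definition invertible_op ::
  "('a::ab_group_add, 'c) hspace_scheme \<Rightarrow> ('b::ab_group_add, 'd) hspace_scheme \<Rightarrow> ('a \<Rightarrow> 'b) \<Rightarrow> bool" where
  "invertible_op H K X \<longleftrightarrow>
     bounded_op H K X \<and>
     (\<exists>Y. bounded_op K H Y \<and> (\<forall>f\<in>hcar H. Y (X f) = f) \<and> (\<forall>g\<in>hcar K. X (Y g) = g))"

definition similar_ops ::
  "('a::ab_group_add, 'c) hspace_scheme \<Rightarrow> ('a \<Rightarrow> 'a) \<Rightarrow>
   ('b::ab_group_add, 'd) hspace_scheme \<Rightarrow> ('b \<Rightarrow> 'b) \<Rightarrow> bool" where
  "similar_ops H A K B \<longleftrightarrow>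
     (\<exists>X. invertible_op H K X \<and> (\<forall>f\<in>hcar H. X (A f) = B (X f)))"

text \<open>The adjoint; by Riesz, the description is proper when T is bounded and g is in the carrier.\<close>

definition adjoint_op :: "('a, 'b) hspace_scheme \<Rightarrow> ('a \<Rightarrow> 'a) \<Rightarrow> 'a \<Rightarrow> 'a" where
  "adjoint_op H T g = (THE h. h \<in> hcar H \<and> (\<forall>f\<in>hcar H. hinner H (T f) g = hinner H f h))"

text \<open>Boundedness of T is deliberately not part of the following predicate,
  so that its negation says that one of the inequalities fails.\<close>

definition n_hypercontraction ::
  "nat \<Rightarrow> ('a::ab_group_add, 'b) hspace_scheme \<Rightarrow> ('a \<Rightarrow> 'a) \<Rightarrow> bool" where
  "n_hypercontraction n H T \<longleftrightarrow>
     (\<forall>k\<in>{1..n}. \<forall>f\<in>hcar H.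
        hinner H
          (\<Sum>j\<le>k. hscale H ((-1) ^ j * of_nat (k choose j)) ((adjoint_op H T ^^ j) ((T ^^ j) f))) f
        \<in> \<real>\<^sub>\<ge>\<^sub>0)"

section \<open>The Cowen-Douglas class and curvature\<close>

definition shifted_op ::
  "('a::ab_group_add, 'b) hspace_scheme \<Rightarrow> ('a \<Rightarrow> 'a) \<Rightarrow> complex \<Rightarrow> 'a \<Rightarrow> 'a" where
  "shifted_op H T z f = T f - hscale H z f"

definition op_spectrum :: "('a::ab_group_add, 'b) hspace_scheme \<Rightarrow> ('a \<Rightarrow> 'a) \<Rightarrow> complex set" where
  "op_spectrum H T = {z. \<not> invertible_op H H (shifted_op H T z)}"

definition op_kernel :: "('a::ab_group_add, 'b) hspace_scheme \<Rightarrow> ('a \<Rightarrow> 'a) \<Rightarrow> 'a set" where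
  "op_kernel H T = {f \<in> hcar H. T f = 0}"

definition cowen_douglas_B1 :: "('a::ab_group_add, 'b) hspace_scheme \<Rightarrow> ('a \<Rightarrow> 'a) \<Rightarrow> bool" where
  "cowen_douglas_B1 H T \<longleftrightarrow>
     hilbert_space H \<and> separable_space (htopology H) \<and> bounded_op H H T \<and>
     ball 0 1 \<subseteq> op_spectrum H T \<and>
     (\<forall>z\<in>ball 0 1. closedin (htopology H) (shifted_op H T z ` hcar H)) \<and>
     (\<forall>z\<in>ball 0 1. vector_space.dim (hscale H) (op_kernel H (shifted_op H T z)) = 1) \<and>
     htopology H closure_of
       module.span (hscale H) (\<Union>z\<in>ball 0 1. op_kernel H (shifted_op H T z)) = hcar H"

definition hilbert_holomorphic_on ::
  "('a::ab_group_add, 'b) hspace_scheme \<Rightarrow> (complex \<Rightarrow> 'a) \<Rightarrow> complex set \<Rightarrow> bool" where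
  "hilbert_holomorphic_on H \<gamma> S \<longleftrightarrow>
     (\<forall>z\<in>S. \<gamma> z \<in> hcar H \<and>
       (\<exists>d\<in>hcar H.
          ((\<lambda>u. hnorm H (hscale H (1 / (u - z)) (\<gamma> u - \<gamma> z) - d)) \<longlongrightarrow> 0) (at z within S)))"

definition kernel_section ::
  "('a::ab_group_add, 'b) hspace_scheme \<Rightarrow> ('a \<Rightarrow> 'a) \<Rightarrow> (complex \<Rightarrow> 'a) \<Rightarrow> bool" where
  "kernel_section H T \<gamma> \<longleftrightarrow>
     hilbert_holomorphic_on H \<gamma> (ball 0 1) \<and>
     (\<forall>z\<in>ball 0 1. \<gamma> z \<noteq> 0 \<and> \<gamma> z \<in> op_kernel H (shifted_op H T z))"

text \<open>The Wirtinger derivatives, with x- and y-derivatives taken in directions 1 and \<open>\<i>\<close>.\<close>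

definition wirtinger :: "(complex \<Rightarrow> complex) \<Rightarrow> complex \<Rightarrow> complex" where
  "wirtinger F z = (frechet_derivative F (at z) 1 - \<i> * frechet_derivative F (at z) \<i>) / 2"

definition wirtinger_bar :: "(complex \<Rightarrow> complex) \<Rightarrow> complex \<Rightarrow> complex" where
  "wirtinger_bar F z = (frechet_derivative F (at z) 1 + \<i> * frechet_derivative F (at z) \<i>) / 2"

definition ddbar :: "(complex \<Rightarrow> real) \<Rightarrow> complex \<Rightarrow> complex" where
  "ddbar u = wirtinger (wirtinger_bar (\<lambda>z. complex_of_real (u z)))"

text \<open>For T in the Cowen-Douglas class a section exists and the value does not depend on
  which one is chosen.\<close>

definition curvature :: "('a::ab_group_add, 'b) hspace_scheme \<Rightarrow> ('a \<Rightarrow> 'a) \<Rightarrow> complex \<Rightarrow> complex" where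
  "curvature H T z =
     (let \<gamma> = (SOME \<gamma>. kernel_section H T \<gamma>) in - ddbar (\<lambda>u. ln ((hnorm H (\<gamma> u))\<^sup>2)) z)"

definition real_analytic_on :: "(complex \<Rightarrow> real) \<Rightarrow> complex set \<Rightarrow> bool" where
  "real_analytic_on u S \<longleftrightarrow>
     (\<forall>p\<in>S. \<exists>r>0. \<exists>a :: nat \<Rightarrow> nat \<Rightarrow> real. \<forall>z\<in>ball p r.
        ((\<lambda>(j, k). a j k * (Re z - Re p) ^ j * (Im z - Im p) ^ k) has_sum u z) UNIV)"

section \<open>Weighted Hardy spaces and shifts\<close>

definition admissible_weight :: "(nat \<Rightarrow> real) \<Rightarrow> bool" where
  "admissible_weight w \<longleftrightarrow>
     (\<forall>j. w j > 0) \<and> liminf (\<lambda>j. ereal (root j \<bar>w j\<bar>)) = 1 \<and>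
     bdd_above (range (\<lambda>j. w (Suc j) / w j))"

text \<open>A function is represented by its power series at 0.\<close>

definition H2 :: "(nat \<Rightarrow> real) \<Rightarrow> complex fps hspace" where
  "H2 w = \<lparr>hcar = {f. summable (\<lambda>j. (cmod (fps_nth f j))\<^sup>2 * w j)},
           hscale = (\<lambda>c f. fps_const c * f),
           hinner = (\<lambda>f g. \<Sum>j. fps_nth f j * cnj (fps_nth g j) * complex_of_real (w j))\<rparr>"

definition forward_shift :: "complex fps \<Rightarrow> complex fps" where
  "forward_shift f = fps_X * f"

definition backward_shift :: "(nat \<Rightarrow> real) \<Rightarrow> complex fps \<Rightarrow> complex fps" where
  "backward_shift w = adjoint_op (H2 w) forward_shift"

definition M_weight :: "nat \<Rightarrow> nat \<Rightarrow> real" where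
  "M_weight n k = inverse (real ((n + k - 1) choose k))"

definition M_space :: "nat \<Rightarrow> complex fps hspace" where
  "M_space n = H2 (M_weight n)"

definition S_adj :: "nat \<Rightarrow> complex fps \<Rightarrow> complex fps" where
  "S_adj n = adjoint_op (M_space n) forward_shift"

section \<open>Basic facts on the weighted spaces\<close>


lemma H2_add:
  assumes w: "\<And>j. w j > 0" and "f \<in> hcar (H2 w)" "g \<in> hcar (H2 w)"
  shows "f + g \<in> hcar (H2 w)"
proof -
  have s: "summable (\<lambda>j. 2 * ((cmod (fps_nth f j))\<^sup>2 * w j) + 2 * ((cmod (fps_nth g j))\<^sup>2 * w j))"
    using assms by (intro summable_add summable_mult) (auto simp: H2_def)
  have "(cmod (a + b))\<^sup>2 \<le> 2 * (cmod a)\<^sup>2 + 2 * (cmod b)\<^sup>2" for a b :: complex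
  proof -
    have "(cmod (a + b))\<^sup>2 \<le> (cmod a + cmod b)\<^sup>2"
      by (intro power_mono norm_triangle_ineq) auto
    also have "\<dots> \<le> 2 * (cmod a)\<^sup>2 + 2 * (cmod b)\<^sup>2"
      using sum_squares_bound[of "cmod a" "cmod b"] by (simp add: power2_sum)
    finally show ?thesis .
  qed
  then have le: "(cmod (fps_nth f j + fps_nth g j))\<^sup>2 * w j
      \<le> 2 * ((cmod (fps_nth f j))\<^sup>2 * w j) + 2 * ((cmod (fps_nth g j))\<^sup>2 * w j)" for j
    using mult_right_mono[of "(cmod (fps_nth f j + fps_nth g j))\<^sup>2" _ "w j"] w[of j]
    by (fastforce simp: algebra_simps)
  have "summable (\<lambda>j. (cmod (fps_nth f j + fps_nth g j))\<^sup>2 * w j)"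
    by (rule summable_comparison_test'[OF s, of 0]) (use le w in \<open>auto simp: less_imp_le\<close>)
  then show ?thesis by (simp add: H2_def)
qed

lemma H2_scale: "f \<in> hcar (H2 w) \<Longrightarrow> fps_const c * f \<in> hcar (H2 w)"
  by (auto simp: H2_def norm_mult power_mult_distrib mult.assoc intro: summable_mult)

lemma H2_inner_summable:
  assumes w: "\<And>j. w j > 0" and "f \<in> hcar (H2 w)" "g \<in> hcar (H2 w)"
  shows "summable (\<lambda>j. cmod (fps_nth f j * cnj (fps_nth g j) * complex_of_real (w j)))"
proof -
  have s: "summable (\<lambda>j. (cmod (fps_nth f j))\<^sup>2 * w j + (cmod (fps_nth g j))\<^sup>2 * w j)"
    using assms by (intro summable_add) (auto simp: H2_def)
  have ab: "a * b \<le> a\<^sup>2 + b\<^sup>2" if "a \<ge> 0" "b \<ge> 0" for a b :: real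
    using sum_squares_bound[of a b] mult_nonneg_nonneg[OF that] by linarith
  have "cmod (fps_nth f j * cnj (fps_nth g j) * complex_of_real (w j))
     \<le> (cmod (fps_nth f j))\<^sup>2 * w j + (cmod (fps_nth g j))\<^sup>2 * w j" for j
    using mult_right_mono[OF ab[of "cmod (fps_nth f j)" "cmod (fps_nth g j)"], of "w j"] w[of j]
    by (simp add: norm_mult algebra_simps)
  then show ?thesis
    by (intro summable_comparison_test'[OF s, of 0]) auto
qed

lemma H2_inner_self:
  assumes w: "\<And>j. w j > 0" and "f \<in> hcar (H2 w)"
  shows "hinner (H2 w) f f = complex_of_real (\<Sum>j. (cmod (fps_nth f j))\<^sup>2 * w j)"
proof -
  have "(\<lambda>j. (cmod (fps_nth f j))\<^sup>2 * w j) sums (\<Sum>j. (cmod (fps_nth f j))\<^sup>2 * w j)"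
    using assms by (auto simp: H2_def intro: summable_sums)
  then have "(\<lambda>j. complex_of_real ((cmod (fps_nth f j))\<^sup>2 * w j)) sums
     complex_of_real (\<Sum>j. (cmod (fps_nth f j))\<^sup>2 * w j)"
    by (rule sums_of_real)
  moreover have "(\<lambda>j. complex_of_real ((cmod (fps_nth f j))\<^sup>2 * w j)) =
      (\<lambda>j. fps_nth f j * cnj (fps_nth f j) * complex_of_real (w j))"
    by (simp add: complex_norm_square flip: of_real_power)
  ultimately show ?thesis
    by (simp add: H2_def sums_iff del: of_real_mult of_real_power)
qed

lemma H2_norm_sq:
  assumes w: "\<And>j. w j > 0" and f: "f \<in> hcar (H2 w)"
  shows "(hnorm (H2 w) f)\<^sup>2 = (\<Sum>j. (cmod (fps_nth f j))\<^sup>2 * w j)"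
  using f unfolding hnorm_def H2_inner_self[OF assms]
  by (simp add: suminf_nonneg H2_def w less_imp_le)

lemma H2_inner_adjoint:
  assumes w: "admissible_weight w" and f: "f \<in> hcar (H2 w)"
  shows "Abs_fps (\<lambda>j. complex_of_real (w (Suc j) / w j) * fps_nth f (Suc j)) \<in> hcar (H2 w)"
    and "g \<in> hcar (H2 w) \<Longrightarrow> hinner (H2 w) (forward_shift g) f =
      hinner (H2 w) g (Abs_fps (\<lambda>j. complex_of_real (w (Suc j) / w j) * fps_nth f (Suc j)))"
proof -
  have pos: "w j > 0" for j using w by (simp add: admissible_weight_def)
  from w obtain C where C: "w (Suc j) / w j \<le> C" for j
    by (auto simp: admissible_weight_def bdd_above_def)
  have s: "summable (\<lambda>j. C * ((cmod (fps_nth f (Suc j)))\<^sup>2 * w (Suc j)))"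
    using f by (intro summable_mult) (simp add: H2_def summable_Suc_iff[of "\<lambda>j. (cmod (fps_nth f j))\<^sup>2 * w j"])
  have "(w (Suc j) / w j)\<^sup>2 * w j \<le> C * w (Suc j)" for j
    using mult_right_mono[OF C[of j], of "w (Suc j)"] pos[of j] pos[of "Suc j"]
    by (simp add: power2_eq_square field_simps)
  then have "(cmod (complex_of_real (w (Suc j) / w j) * fps_nth f (Suc j)))\<^sup>2 * w j
      \<le> C * ((cmod (fps_nth f (Suc j)))\<^sup>2 * w (Suc j))" for j
    using mult_left_mono[of "(w (Suc j) / w j)\<^sup>2 * w j" "C * w (Suc j)" "(cmod (fps_nth f (Suc j)))\<^sup>2"]
    by (simp add: norm_mult power_mult_distrib norm_divide power_divide mult_ac)
  then have "summable (\<lambda>j. (cmod (complex_of_real (w (Suc j) / w j) * fps_nth f (Suc j)))\<^sup>2 * w j)"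
    by (intro summable_comparison_test'[OF s, of 0]) (use pos in \<open>auto simp: less_imp_le\<close>)
  then show "Abs_fps (\<lambda>j. complex_of_real (w (Suc j) / w j) * fps_nth f (Suc j)) \<in> hcar (H2 w)"
    by (simp add: H2_def)
next
  have pos: "w j > 0" for j using w by (simp add: admissible_weight_def)
  let ?u = "\<lambda>j. fps_nth (fps_X * g) j * cnj (fps_nth f j) * complex_of_real (w j)"
  assume g: "g \<in> hcar (H2 w)"
  have "?u (Suc j) = fps_nth g j * cnj (complex_of_real (w (Suc j) / w j) * fps_nth f (Suc j))
      * complex_of_real (w j)" for j
    using pos[of j] by (simp add: field_simps)
  moreover have "suminf ?u = suminf (\<lambda>j. ?u (Suc j))"
  proof -
    have "?u sums x \<longleftrightarrow> (\<lambda>j. ?u (Suc j)) sums x" for x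
      using sums_Suc_iff[of ?u x] by simp
    then show ?thesis unfolding suminf_def by presburger
  qed
  ultimately show "hinner (H2 w) (forward_shift g) f =
      hinner (H2 w) g (Abs_fps (\<lambda>j. complex_of_real (w (Suc j) / w j) * fps_nth f (Suc j)))"
    by (simp add: H2_def forward_shift_def)
qed

lemma H2_inner_monom:
  "hinner (H2 w) (fps_X ^ k) f = cnj (fps_nth f k) * complex_of_real (w k)"
proof -
  have "(\<lambda>j. fps_nth (fps_X ^ k) j * cnj (fps_nth f j) * complex_of_real (w j)) sums
     (cnj (fps_nth f k) * complex_of_real (w k))"
    using sums_If_finite_set[of "{k}" "\<lambda>j. cnj (fps_nth f j) * complex_of_real (w j)"]
    by (simp add: fps_X_power_nth if_distrib[of "\<lambda>x. x * _"] cong: if_cong)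
  then show ?thesis by (simp add: H2_def sums_iff)
qed

lemma H2_monom: "fps_X ^ k \<in> hcar (H2 w)"
  using summable_If_finite_set[of "{k}" "w"]
  by (simp add: H2_def fps_X_power_nth if_distrib[of cmod] if_distrib[of "\<lambda>x. x ^ 2"]
     if_distrib[of "\<lambda>x. x * _"] cong: if_cong)

text \<open>The adjoint is the expected weighted backward shift.\<close>

lemma backward_shift_eq:
  assumes w: "admissible_weight w" and f: "f \<in> hcar (H2 w)"
  shows "backward_shift w f = Abs_fps (\<lambda>j. complex_of_real (w (Suc j) / w j) * fps_nth f (Suc j))"
  unfolding backward_shift_def adjoint_op_def
proof (rule the_equality)
  fix h assume h: "h \<in> hcar (H2 w) \<and> (\<forall>g\<in>hcar (H2 w). hinner (H2 w) (forward_shift g) f = hinner (H2 w) g h)"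
  show "h = Abs_fps (\<lambda>j. complex_of_real (w (Suc j) / w j) * fps_nth f (Suc j))"
  proof (rule fps_ext)
    fix k
    have "hinner (H2 w) (forward_shift (fps_X ^ k)) f = hinner (H2 w) (fps_X ^ k) h"
      using h H2_monom by blast
    then have "cnj (fps_nth f (Suc k)) * complex_of_real (w (Suc k)) = cnj (fps_nth h k) * complex_of_real (w k)"
      using H2_inner_monom[of w "Suc k" f] by (simp add: forward_shift_def H2_inner_monom)
    then have "fps_nth f (Suc k) * complex_of_real (w (Suc k)) = fps_nth h k * complex_of_real (w k)"
      by (metis complex_cnj_cnj complex_cnj_complex_of_real complex_cnj_mult)
    moreover have "w k > 0" using w by (simp add: admissible_weight_def)
    ultimately show "fps_nth h k = fps_nth (Abs_fps (\<lambda>j. complex_of_real (w (Suc j) / w j) * fps_nth f (Suc j))) k"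
      by (simp add: field_simps)
  qed
qed (use H2_inner_adjoint[OF assms] in auto)

lemma H2_minus:
  assumes w: "\<And>j. w j > 0" and "f \<in> hcar (H2 w)" "g \<in> hcar (H2 w)"
  shows "f - g \<in> hcar (H2 w)"
proof -
  have "f + fps_const (-1) * g \<in> hcar (H2 w)"
    by (intro H2_add H2_scale assms)
  then show ?thesis by (simp flip: fps_const_neg)
qed

lemma H2_normI:
  assumes w: "\<And>j. w j > 0" and C: "C \<ge> 0"
    and le: "\<And>N. (\<Sum>j<N. (cmod (fps_nth f j))\<^sup>2 * w j) \<le> C\<^sup>2"
  shows "f \<in> hcar (H2 w)" "hnorm (H2 w) f \<le> C"
proof -
  have s: "summable (\<lambda>j. (cmod (fps_nth f j))\<^sup>2 * w j)"
    by (rule summableI_nonneg_bounded[OF _ le]) (simp add: w less_imp_le)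
  then show f: "f \<in> hcar (H2 w)" by (simp add: H2_def)
  have "(hnorm (H2 w) f)\<^sup>2 \<le> C\<^sup>2"
    unfolding H2_norm_sq[OF w f] by (rule suminf_le_const[OF s le])
  then show "hnorm (H2 w) f \<le> C" using C by (rule power2_le_imp_le)
qed

lemma hnorm_H2_nonneg:
  assumes w: "\<And>j. w j > 0" and f: "f \<in> hcar (H2 w)"
  shows "hnorm (H2 w) f \<ge> 0"
  using f unfolding hnorm_def H2_inner_self[OF assms]
  by (simp add: suminf_nonneg H2_def w less_imp_le)

lemma H2_partial_sum:
  assumes w: "\<And>j. w j > 0" and f: "f \<in> hcar (H2 w)"
  shows "L2_set (\<lambda>j. cmod (fps_nth f j) * sqrt (w j)) {..<N} \<le> hnorm (H2 w) f"
proof -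
  have "(\<Sum>j<N. (cmod (fps_nth f j))\<^sup>2 * w j) \<le> (hnorm (H2 w) f)\<^sup>2"
    unfolding H2_norm_sq[OF assms]
    by (rule sum_le_suminf) (use f w in \<open>auto simp: H2_def less_imp_le\<close>)
  then have "sqrt (\<Sum>j<N. (cmod (fps_nth f j))\<^sup>2 * w j) \<le> hnorm (H2 w) f"
    using hnorm_H2_nonneg[OF assms] by (simp add: real_le_lsqrt)
  then show ?thesis
    by (simp add: L2_set_def power_mult_distrib w less_imp_le)
qed

lemma H2_triangle:
  assumes w: "\<And>j. w j > 0" and f: "f \<in> hcar (H2 w)" and g: "g \<in> hcar (H2 w)"
  shows "hnorm (H2 w) (f + g) \<le> hnorm (H2 w) f + hnorm (H2 w) g"
proof (rule H2_normI(2)[OF w])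
  show "0 \<le> hnorm (H2 w) f + hnorm (H2 w) g" using hnorm_H2_nonneg[OF w] f g by simp
  fix N
  have "L2_set (\<lambda>j. cmod (fps_nth (f + g) j) * sqrt (w j)) {..<N}
     \<le> L2_set (\<lambda>j. cmod (fps_nth f j) * sqrt (w j) + cmod (fps_nth g j) * sqrt (w j)) {..<N}"
    by (rule L2_set_mono) (auto simp: w less_imp_le norm_triangle_ineq mult_right_mono simp flip: distrib_right)
  also have "\<dots> \<le> hnorm (H2 w) f + hnorm (H2 w) g"
    by (rule order_trans[OF L2_set_triangle_ineq add_mono[OF H2_partial_sum[OF w f] H2_partial_sum[OF w g]]])
  finally have "sqrt (\<Sum>j<N. (cmod (fps_nth (f + g) j))\<^sup>2 * w j) \<le> hnorm (H2 w) f + hnorm (H2 w) g"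
    by (simp add: L2_set_def power_mult_distrib w less_imp_le)
  then show "(\<Sum>j<N. (cmod (fps_nth (f + g) j))\<^sup>2 * w j) \<le> (hnorm (H2 w) f + hnorm (H2 w) g)\<^sup>2"
    by (rule sqrt_le_D)
qed

lemma H2_coeff_le:
  assumes w: "\<And>j. w j > 0" and f: "f \<in> hcar (H2 w)"
  shows "cmod (fps_nth f j) * sqrt (w j) \<le> hnorm (H2 w) f"
  using H2_partial_sum[OF assms, of "Suc j"]
    member_le_L2_set[of "{..<Suc j}" j "\<lambda>j. cmod (fps_nth f j) * sqrt (w j)"]
  by auto

lemma hnorm_H2_uminus: "hnorm (H2 w) (f - g) = hnorm (H2 w) (g - f)"
  by (simp add: hnorm_def H2_def algebra_simps)

lemma Metric_space_H2:
  assumes w: "\<And>j. w j > 0"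
  shows "Metric_space (hcar (H2 w)) (hdist (H2 w))"
proof
  fix f g
  show "0 \<le> hdist (H2 w) f g"
    by (simp add: hdist_def hnorm_H2_nonneg[OF w] H2_minus[OF w])
  show "hdist (H2 w) f g = hdist (H2 w) g f"
    by (simp add: hdist_def hnorm_H2_uminus)
  assume f: "f \<in> hcar (H2 w)" and g: "g \<in> hcar (H2 w)"
  show "hdist (H2 w) f g = 0 \<longleftrightarrow> f = g"
  proof
    assume "hdist (H2 w) f g = 0"
    then have "cmod (fps_nth (f - g) j) * sqrt (w j) \<le> 0" for j
      using H2_coeff_le[OF w H2_minus[OF w f g], of j] by (simp add: hdist_def f g)
    then have "fps_nth (f - g) j = 0" for j
      by (metis mult_le_0_iff norm_le_zero_iff not_le real_sqrt_gt_0_iff w)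
    then show "f = g" by (simp add: fps_eq_iff)
  qed (simp add: hdist_def hnorm_def H2_def)
  fix h assume h: "h \<in> hcar (H2 w)"
  show "hdist (H2 w) f h \<le> hdist (H2 w) f g + hdist (H2 w) g h"
    using H2_triangle[OF w H2_minus[OF w f g] H2_minus[OF w g h]] by (simp add: hdist_def f g h)
qed

lemma H2_complete:
  assumes w: "\<And>j. w j > 0"
  shows "Metric_space.mcomplete (hcar (H2 w)) (hdist (H2 w))"
proof -
  interpret Metric_space "hcar (H2 w)" "hdist (H2 w)" by (rule Metric_space_H2[OF w])
  show ?thesis unfolding mcomplete_def
  proof (intro allI impI)
    fix \<sigma> assume C: "MCauchy \<sigma>"
    then have m: "\<sigma> k \<in> hcar (H2 w)" for k by (auto simp: MCauchy_def)
    have N: "\<exists>N. \<forall>k\<ge>N. \<forall>l\<ge>N. hnorm (H2 w) (\<sigma> k - \<sigma> l) < e" if "e > 0" for e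
      using C that m by (auto simp: MCauchy_def hdist_def)
    have "Cauchy (\<lambda>k. fps_nth (\<sigma> k) j)" for j
    proof (rule CauchyI)
      fix e :: real assume "e > 0"
      then obtain N where "\<forall>k\<ge>N. \<forall>l\<ge>N. hnorm (H2 w) (\<sigma> k - \<sigma> l) < e * sqrt (w j)"
        using N[of "e * sqrt (w j)"] w[of j] by auto
      then have "cmod (fps_nth (\<sigma> k - \<sigma> l) j) * sqrt (w j) < e * sqrt (w j)" if "k \<ge> N" "l \<ge> N" for k l
        using H2_coeff_le[OF w H2_minus[OF w m m]] that by (meson le_less_trans)
      then show "\<exists>N. \<forall>k\<ge>N. \<forall>l\<ge>N. norm (fps_nth (\<sigma> k) j - fps_nth (\<sigma> l) j) < e"
        using w[of j] by (auto intro!: exI[of _ N])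
    qed
    then have "\<exists>a. (\<lambda>k. fps_nth (\<sigma> k) j) \<longlonglongrightarrow> a" for j
      by (simp add: Cauchy_convergent_iff convergent_def)
    then obtain a where a: "(\<lambda>k. fps_nth (\<sigma> k) j) \<longlonglongrightarrow> a j" for j by metis
    define f where "f = Abs_fps a"
    have key: "\<exists>N. \<forall>k\<ge>N. \<sigma> k - f \<in> hcar (H2 w) \<and> hnorm (H2 w) (\<sigma> k - f) \<le> e" if e: "e > 0" for e
    proof -
      obtain N where N: "\<forall>k\<ge>N. \<forall>l\<ge>N. hnorm (H2 w) (\<sigma> k - \<sigma> l) < e" using N[OF e] by blast
      have "(\<Sum>j<J. (cmod (fps_nth (\<sigma> k - f) j))\<^sup>2 * w j) \<le> e\<^sup>2" if k: "k \<ge> N" for k J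
      proof (rule tendsto_upperbound)
        show "(\<lambda>l. \<Sum>j<J. (cmod (fps_nth (\<sigma> k - \<sigma> l) j))\<^sup>2 * w j)
           \<longlonglongrightarrow> (\<Sum>j<J. (cmod (fps_nth (\<sigma> k - f) j))\<^sup>2 * w j)"
          unfolding f_def fps_sub_nth fps_nth_Abs_fps by (intro tendsto_intros a)
        show "\<forall>\<^sub>F l in sequentially. (\<Sum>j<J. (cmod (fps_nth (\<sigma> k - \<sigma> l) j))\<^sup>2 * w j) \<le> e\<^sup>2"
        proof (rule eventually_sequentiallyI[of N])
          fix l assume "l \<ge> N"
          then have "L2_set (\<lambda>j. cmod (fps_nth (\<sigma> k - \<sigma> l) j) * sqrt (w j)) {..<J} \<le> e"
            using N k H2_partial_sum[OF w H2_minus[OF w m m], of k l J] by (meson le_less_trans less_imp_le)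
          then show "(\<Sum>j<J. (cmod (fps_nth (\<sigma> k - \<sigma> l) j))\<^sup>2 * w j) \<le> e\<^sup>2"
            by (intro sqrt_le_D) (simp add: L2_set_def power_mult_distrib w less_imp_le)
        qed
      qed simp
      then show ?thesis
        using H2_normI[of w e "\<sigma> _ - f"] w e by (intro exI[of _ N]) auto
    qed
    obtain k where "\<sigma> k - f \<in> hcar (H2 w)" using key[of 1] by auto
    then have f: "f \<in> hcar (H2 w)"
      using H2_minus[OF w m[of k]] by fastforce
    have "\<exists>N. \<forall>k\<ge>N. hdist (H2 w) (\<sigma> k) f < e" if e: "e > 0" for e
      using key[of "e / 2"] e by (fastforce simp: hdist_def f m)
    then have "limitin mtopology \<sigma> f sequentially"
      by (simp add: limit_metric_sequentially f m)
    then show "\<exists>f. limitin mtopology \<sigma> f sequentially" by blast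
  qed
qed

lemma hilbert_space_H2:
  assumes w: "\<And>j. w j > 0"
  shows "hilbert_space (H2 w)"
proof -
  let ?s = "\<lambda>c f. fps_const c * (f :: complex fps)"
  interpret vs: vector_space ?s
    by standard (simp_all add: algebra_simps flip: fps_const_mult fps_const_add)
  have sc: "hscale (H2 w) = ?s" by (simp add: H2_def)
  have "module.subspace ?s (hcar (H2 w))"
    unfolding vs.subspace_def using H2_add[OF w] H2_scale by (auto simp: H2_def)
  moreover have "hinner (H2 w) g f = cnj (hinner (H2 w) f g)"
    if "f \<in> hcar (H2 w)" "g \<in> hcar (H2 w)" for f g
  proof -
    have "(\<lambda>j. fps_nth f j * cnj (fps_nth g j) * complex_of_real (w j)) sums hinner (H2 w) f g"
      using H2_inner_summable[OF w that] by (auto simp: H2_def intro: summable_sums summable_norm_cancel)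
    then have "(\<lambda>j. cnj (fps_nth f j * cnj (fps_nth g j) * complex_of_real (w j))) sums cnj (hinner (H2 w) f g)"
      by (simp only: sums_cnj)
    then show ?thesis by (simp add: H2_def sums_iff mult_ac)
  qed
  moreover have "hinner (H2 w) (f + g) h = hinner (H2 w) f h + hinner (H2 w) g h"
    if "f \<in> hcar (H2 w)" "g \<in> hcar (H2 w)" "h \<in> hcar (H2 w)" for f g h
    using suminf_add[OF H2_inner_summable[OF w that(1,3), THEN summable_norm_cancel]
                        H2_inner_summable[OF w that(2,3), THEN summable_norm_cancel]]
    by (simp add: H2_def algebra_simps)
  moreover have "hinner (H2 w) (fps_const c * f) g = c * hinner (H2 w) f g"
    if "f \<in> hcar (H2 w)" "g \<in> hcar (H2 w)" for c f g
    using suminf_mult[OF H2_inner_summable[OF w that, THEN summable_norm_cancel], of c]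
    by (simp add: H2_def mult.assoc)
  moreover have "hinner (H2 w) f f \<in> \<real>\<^sub>\<ge>\<^sub>0" if "f \<in> hcar (H2 w)" for f
  proof -
    have "0 \<le> (\<Sum>j. (cmod (fps_nth f j))\<^sup>2 * w j)"
      using that by (intro suminf_nonneg) (auto simp: H2_def w less_imp_le)
    then show ?thesis unfolding H2_inner_self[OF w that] by simp
  qed
  moreover have "f = 0" if f: "f \<in> hcar (H2 w)" and 0: "hinner (H2 w) f f = 0" for f
  proof (rule fps_ext)
    fix j
    have "cmod (fps_nth f j) * sqrt (w j) \<le> 0"
      using H2_coeff_le[OF w f, of j] 0 by (simp add: hnorm_def)
    then show "fps_nth f j = fps_nth 0 j"
      using w[of j] by (simp add: mult_le_0_iff not_le)
  qed
  ultimately show ?thesis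
    unfolding hilbert_space_def sc
    using vs.vector_space_axioms H2_complete[of w, OF w] by (intro conjI ballI allI impI; meson)
qed

lemma M_weight_pos: "n \<ge> 1 \<Longrightarrow> M_weight n k > 0"
  by (simp add: M_weight_def zero_less_binomial_iff)

text \<open>Elements of the n-th space are Taylor series of analytic functions on the unit disk.\<close>

lemma M_space_conv_radius:
  assumes n: "n \<ge> 1" and f: "f \<in> hcar (M_space n)"
  shows "fps_conv_radius f \<ge> 1"
  unfolding fps_conv_radius_def
proof (rule conv_radius_geI_ex')
  fix r :: real assume "0 < r" "ereal r < 1"
  then have r: "0 < r" "r < 1" by auto
  have pos: "M_weight n k > 0" for k using M_weight_pos[OF n] .
  have eq: "(- real n gchoose k) * (- (r\<^sup>2)) ^ k = r ^ (2 * k) / M_weight n k" for k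
  proof -
    have n': "real n + real k - 1 = real (n + k - 1)" using n by (simp add: of_nat_diff)
    have "(- real n gchoose k) * (- (r\<^sup>2)) ^ k
        = ((-1) ^ k * (- (r\<^sup>2)) ^ k) * (real (n + k - 1) gchoose k)"
      by (simp only: gbinomial_minus n' mult_ac)
    also have "(-1) ^ k * (- (r\<^sup>2)) ^ k = r ^ (2 * k)"
      by (simp add: power_mult flip: power_mult_distrib)
    also have "real (n + k - 1) gchoose k = inverse (M_weight n k)"
      unfolding M_weight_def by (simp only: binomial_gbinomial inverse_inverse_eq)
    finally show ?thesis by (simp only: divide_inverse)
  qed
  have "summable (\<lambda>k. (- real n gchoose k) * (- (r\<^sup>2)) ^ k)"
  proof -
    have "r\<^sup>2 < 1" using r by (simp add: power2_eq_square mult_less_cancel_left2 mult_strict_mono[of r 1 r 1, simplified])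
    then have "\<bar>- (r\<^sup>2)\<bar> < 1" by simp
    from gen_binomial_real[OF this, of "- real n"] show ?thesis by (rule sums_summable)
  qed
  then have s: "summable (\<lambda>k. (cmod (fps_nth f k))\<^sup>2 * M_weight n k + r ^ (2 * k) / M_weight n k)"
    unfolding eq using f by (intro summable_add) (auto simp: M_space_def H2_def)
  have le: "cmod (fps_nth f k) * r ^ k \<le> (cmod (fps_nth f k))\<^sup>2 * M_weight n k + r ^ (2 * k) / M_weight n k" for k
  proof -
    define a b where "a = cmod (fps_nth f k) * sqrt (M_weight n k)" and "b = r ^ k / sqrt (M_weight n k)"
    have "0 \<le> a * b" using r pos[of k] by (simp add: a_def b_def)
    then have "a * b \<le> a\<^sup>2 + b\<^sup>2" using sum_squares_bound[of a b] by linarith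
    moreover have "a * b = cmod (fps_nth f k) * r ^ k"
      using pos[of k] by (simp add: a_def b_def)
    moreover have "a\<^sup>2 = (cmod (fps_nth f k))\<^sup>2 * M_weight n k"
      using pos[of k] by (simp add: a_def power_mult_distrib)
    moreover have "b\<^sup>2 = r ^ (2 * k) / M_weight n k"
      using pos[of k] by (simp add: b_def power_divide mult.commute flip: power_mult)
    ultimately show ?thesis by simp
  qed
  show "summable (\<lambda>k. fps_nth f k * complex_of_real r ^ k)"
    by (rule summable_comparison_test'[OF s, of 0]) (use le r in \<open>simp add: norm_mult norm_power\<close>)
qed

end

theory Submission
  imports Defs "HOL-Complex_Analysis.Cauchy_Integral_Formula"
begin

text \<open>
  Write \<open>1 / w j = b j\<close>. The kernel of \<open>T - u\<close> for the backward shift \<open>T\<close> on \<open>H\<^sup>2\<^sub>w\<close> is spanned by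
  \<open>\<Sum>j. b j * u ^ j * z ^ j\<close>, whose squared norm is \<open>A (\<bar>u\<bar>\<^sup>2)\<close> with \<open>A x = \<Sum>j. b j * x ^ j\<close>.
  For \<open>S\<^sub>n\<^sup>*\<close> the corresponding coefficients are \<open>m j = (n + j - 1) choose j\<close>, with sum \<open>B x\<close>. Hence
  \<open>\<psi> = ln (A (\<bar>u\<bar>\<^sup>2)) - ln (B (\<bar>u\<bar>\<^sup>2)) + 1\<close> has the required Laplacian, and the theorem asks for
  coefficients \<open>b\<close> whose power series is comparable with that of \<open>m\<close> on the interval [0,1) although
  the coefficients themselves are not comparable: the former makes \<open>\<psi>\<close> bounded, the latter rules
  out similarity.

  The choice is \<open>b j = r j * m j\<close> (\<open>b\<close>, \<open>r\<close> and \<open>m\<close> are \<open>bumped_coeff\<close>, \<open>bump_factor\<close> and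
  \<open>kernel_coeff\<close> below), where \<open>r\<close> is 1 away from the sparse points \<open>2 * 16 ^ k\<close> and
  climbs linearly, with slope \<open>1 / 2 ^ k\<close>, to a peak of height about \<open>2 ^ k\<close> there. The peaks are so
  sparse that the averages of \<open>r\<close> stay bounded (\<open>sum_bump_factor_le\<close>); as \<open>m\<close> increases, the partial sums of
  \<open>b\<close> are then at most a constant times those of \<open>m\<close>, and summation by parts
  (\<open>power_series_le_of_partial_sums_le\<close>) transfers this to \<open>A \<le> const * B\<close>. The slopes are
  bounded, so \<open>b (j + l) / b j\<close> grows at most polynomially in \<open>l\<close>, uniformly in \<open>j\<close>. This is
  what keeps \<open>T\<close> in the Cowen-Douglas class: it makes the Neumann series for a right inverse of
  \<open>T - u\<close> converge on the whole disk (\<open>shift_minus_surjective\<close>). Finally \<open>b 0\<close> alone is enlarged to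
  \<open>n + 1 > n = b 1\<close>, so that \<open>T\<close> expands the vector \<open>z\<close> and is not even a contraction.

  Since \<open>A\<close> and \<open>B\<close> are positive on [0,1), their logarithms extend holomorphically
  to a neighbourhood of each point of that interval; substituting \<open>\<bar>u\<bar>\<^sup>2\<close>, a polynomial in the real coordinates, gives
  real analyticity (\<open>real_analytic_on_radial\<close>).
\<close>

section \<open>Real-analytic radial functions\<close>

text \<open>Collecting equal monomials of an unconditionally convergent family. It reduces real
  analyticity to exhibiting any such family of monomials, whatever its index set.\<close>

lemma monomial_family_regroup:
  fixes C :: "'i \<Rightarrow> real" and e f :: "'i \<Rightarrow> nat"
  assumes "((\<lambda>i. C i * s ^ e i * t ^ f i) has_sum S) I"
  shows "((\<lambda>(j, k). (\<Sum>\<^sub>\<infinity>i\<in>{i \<in> I. e i = j \<and> f i = k}. C i) * s ^ j * t ^ k) has_sum S) UNIV"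
proof -
  let ?F = "\<lambda>p. {i \<in> I. e i = fst p \<and> f i = snd p}"
  have bij: "bij_betw (\<lambda>i. ((e i, f i), i)) I (Sigma UNIV ?F)"
    by (rule bij_betwI[of _ _ _ snd]) auto
  have hs: "((\<lambda>(p, i). C i * s ^ fst p * t ^ snd p) has_sum S) (Sigma UNIV ?F)"
    using assms by (subst has_sum_reindex_bij_betw[OF bij, symmetric]) simp
  have fib: "((\<lambda>i. C i * s ^ fst p * t ^ snd p) has_sum
      ((\<Sum>\<^sub>\<infinity>i\<in>?F p. C i) * s ^ fst p * t ^ snd p)) (?F p)" for p
  proof -
    have "(\<lambda>i. C i * s ^ e i * t ^ f i) summable_on ?F p"
      by (rule summable_on_subset_banach[OF has_sum_imp_summable[OF assms]]) auto
    then have "(\<lambda>i. C i * s ^ fst p * t ^ snd p) summable_on ?F p"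
      by (rule summable_on_cong[THEN iffD1, rotated]) auto
    then have "((\<lambda>i. C i * s ^ fst p * t ^ snd p) has_sum
        (\<Sum>\<^sub>\<infinity>i\<in>?F p. C i * s ^ fst p * t ^ snd p)) (?F p)"
      by (rule has_sum_infsum)
    then show ?thesis by (simp add: infsum_cmult_left')
  qed
  have "((\<lambda>p. (\<Sum>\<^sub>\<infinity>i\<in>?F p. C i) * s ^ fst p * t ^ snd p) has_sum S) UNIV"
    using has_sum_SigmaD[OF hs] fib by simp
  then show ?thesis by (simp add: case_prod_unfold)
qed

text \<open>Expanding a power of a sum into words rather than by the multinomial theorem
  keeps coefficients trivial: each word contributes one monomial.\<close>

lemma sum_over_words:
  fixes f :: "'a \<Rightarrow> 'b::comm_semiring_1"
  assumes "finite S"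
  shows "(\<Sum>xs | set xs \<subseteq> S \<and> length xs = n. prod_list (map f xs)) = (\<Sum>x\<in>S. f x) ^ n"
proof (induction n)
  case 0
  have "{xs. set xs \<subseteq> S \<and> length xs = 0} = {[]}" by auto
  then show ?case by simp
next
  case (Suc n)
  have "(\<Sum>xs | set xs \<subseteq> S \<and> length xs = Suc n. prod_list (map f xs))
      = (\<Sum>p\<in>S \<times> {xs. set xs \<subseteq> S \<and> length xs = n}. f (fst p) * prod_list (map f (snd p)))"
    by (rule sum.reindex_bij_witness[of _ "\<lambda>(x, xs). x # xs" "\<lambda>xs. (hd xs, tl xs)"])
       (auto simp: length_Suc_conv)
  then show ?case
    using Suc.IH by (simp add: sum_product sum.cartesian_product case_prod_beta flip: Suc.IH)
qed

text \<open>With \<open>s\<close> and \<open>t\<close> the real coordinates of \<open>u - p\<close>, one has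
  \<open>\<bar>u\<bar>\<^sup>2 - \<bar>p\<bar>\<^sup>2 = 2 * Re p * s + s\<^sup>2 + 2 * Im p * t + t\<^sup>2\<close>. Substituting this in the expansion of
  \<open>L\<close> at \<open>\<bar>p\<bar>\<^sup>2\<close> gives one monomial for each word in these four letters. For small \<open>s\<close> and
  \<open>t\<close> the sum of the absolute values of the letters is still inside the radius of convergence, so the
  family converges absolutely and may be regrouped.\<close>

lemma real_analytic_on_radial:
  assumes L: "\<And>x\<^sub>0. 0 \<le> x\<^sub>0 \<Longrightarrow> x\<^sub>0 < 1 \<Longrightarrow>
    \<exists>\<rho>>0. \<exists>c. \<forall>x. \<bar>x - x\<^sub>0\<bar> < \<rho> \<longrightarrow> (\<lambda>k. c k * (x - x\<^sub>0) ^ k) sums L x"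
  shows "real_analytic_on (\<lambda>u. L ((cmod u)\<^sup>2)) (ball 0 1)"
  unfolding real_analytic_on_def
proof
  fix p :: complex assume p: "p \<in> ball 0 1"
  define x\<^sub>0 where "x\<^sub>0 = (cmod p)\<^sup>2"
  have x\<^sub>0: "0 \<le> x\<^sub>0" "x\<^sub>0 < 1" using p by (auto simp: x\<^sub>0_def power_less_one_iff)
  obtain \<rho> c where \<rho>: "\<rho> > 0"
    and c: "\<And>x. \<bar>x - x\<^sub>0\<bar> < \<rho> \<Longrightarrow> (\<lambda>k. c k * (x - x\<^sub>0) ^ k) sums L x"
    using L[OF x\<^sub>0] by blast
  have abs_c: "summable (\<lambda>k. \<bar>c k * y ^ k\<bar>)" if "\<bar>y\<bar> < \<rho>" for y
  proof -
    from that \<rho> have "0 \<le> (\<bar>y\<bar> + \<rho>) / 2" "(\<bar>y\<bar> + \<rho>) / 2 < \<rho>" by auto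
    then have "\<bar>(x\<^sub>0 + (\<bar>y\<bar> + \<rho>) / 2) - x\<^sub>0\<bar> < \<rho>" by simp
    from sums_summable[OF c[OF this]] have "summable (\<lambda>k. c k * ((\<bar>y\<bar> + \<rho>) / 2) ^ k)" by simp
    then show ?thesis
      using powser_insidea[of c "(\<bar>y\<bar> + \<rho>) / 2" y] that by simp
  qed
  (* A letter records the coefficient and the exponents of s and t of one of the four summands. *)
  define S :: "(real \<times> nat \<times> nat) set"
    where "S = {(2 * Re p, 1, 0), (1, 2, 0), (2 * Im p, 0, 1), (1, 0, 2)}"
  have finS: "finite S" by (simp add: S_def)
  define I where "I = {xs. set xs \<subseteq> S}"
  define C where "C xs = c (length xs) * prod_list (map fst xs)" for xs :: "(real \<times> nat \<times> nat) list"
  define e where "e xs = sum_list (map (fst \<circ> snd) xs)" for xs :: "(real \<times> nat \<times> nat) list"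
  define f where "f xs = sum_list (map (snd \<circ> snd) xs)" for xs :: "(real \<times> nat \<times> nat) list"
  define r where "r = min 1 (\<rho> / 8)"
  have r: "r > 0" "r \<le> 1" "8 * r \<le> \<rho>" using \<rho> by (auto simp: r_def)
  have "((\<lambda>xs. C xs * (Re z - Re p) ^ e xs * (Im z - Im p) ^ f xs) has_sum L ((cmod z)\<^sup>2)) I"
    if z: "z \<in> ball p r" for z
  proof -
    define s t where "s = Re z - Re p" and "t = Im z - Im p"
    have s: "\<bar>s\<bar> < r" and t: "\<bar>t\<bar> < r"
      using z abs_Re_le_cmod[of "p - z"] abs_Im_le_cmod[of "p - z"]
      by (auto simp: s_def t_def dist_norm)
    define v where "v x = fst x * s ^ fst (snd x) * t ^ snd (snd x)" for x :: "real \<times> nat \<times> nat"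
    have vS: "(\<Sum>x\<in>S. v x) = (cmod z)\<^sup>2 - x\<^sub>0"
      by (simp add: S_def v_def x\<^sub>0_def cmod_power2 s_def t_def) (simp add: power2_eq_square algebra_simps)
    have absv: "(\<Sum>x\<in>S. \<bar>v x\<bar>) < \<rho>"
    proof -
      have sq: "y\<^sup>2 \<le> r" if "\<bar>y\<bar> < r" for y :: real
      proof -
        have "\<bar>y\<bar> * \<bar>y\<bar> \<le> 1 * \<bar>y\<bar>" using that r by (intro mult_right_mono) auto
        then show ?thesis using that by (simp add: power2_eq_square)
      qed
      have lin: "\<bar>2 * a * y\<bar> \<le> 2 * r" if "\<bar>y\<bar> < r" "\<bar>a\<bar> \<le> 1" for a y :: real
      proof -
        have "\<bar>a\<bar> * \<bar>y\<bar> \<le> 1 * \<bar>y\<bar>" using that by (intro mult_right_mono) auto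
        then show ?thesis using that by (simp add: abs_mult)
      qed
      have p1: "\<bar>Re p\<bar> \<le> 1" "\<bar>Im p\<bar> \<le> 1"
        using p abs_Re_le_cmod[of p] abs_Im_le_cmod[of p] by auto
      have "(\<Sum>x\<in>S. \<bar>v x\<bar>) = \<bar>2 * Re p * s\<bar> + s\<^sup>2 + \<bar>2 * Im p * t\<bar> + t\<^sup>2"
        by (simp add: S_def v_def)
      also have "\<dots> \<le> 6 * r"
        using sq[OF s] sq[OF t] lin[OF s p1(1)] lin[OF t p1(2)] by linarith
      finally show ?thesis using r by linarith
    qed
    define W where "W k = {xs :: (real \<times> nat \<times> nat) list. set xs \<subseteq> S \<and> length xs = k}" for k
    have finW: "finite (W k)" for k unfolding W_def by (rule finite_lists_length_eq[OF finS])
    define g where "g = (\<lambda>(k, xs). c k * prod_list (map v xs))"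
    have "(\<lambda>p. \<bar>g p\<bar>) summable_on Sigma UNIV W"
    proof (rule summable_on_SigmaI)
      fix k :: nat
      have abs_word: "\<bar>prod_list (map v xs)\<bar> = prod_list (map (\<lambda>x. \<bar>v x\<bar>) xs)" for xs
        by (induction xs) (auto simp: abs_mult)
      have "(\<Sum>xs\<in>W k. \<bar>g (k, xs)\<bar>) = \<bar>c k * (\<Sum>x\<in>S. \<bar>v x\<bar>) ^ k\<bar>"
        using sum_over_words[OF finS, of "\<lambda>x. \<bar>v x\<bar>" k]
        by (simp add: W_def g_def abs_mult abs_word power_abs sum_nonneg flip: sum_distrib_left)
      then show "((\<lambda>xs. \<bar>g (k, xs)\<bar>) has_sum \<bar>c k * (\<Sum>x\<in>S. \<bar>v x\<bar>) ^ k\<bar>) (W k)"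
        using has_sum_finite[OF finW] by metis
    next
      show "(\<lambda>k. \<bar>c k * (\<Sum>x\<in>S. \<bar>v x\<bar>) ^ k\<bar>) summable_on UNIV"
        using abs_c[of "\<Sum>x\<in>S. \<bar>v x\<bar>"] absv
        by (subst summable_on_UNIV_nonneg_real_iff) (auto simp: sum_nonneg)
    qed auto
    then have gs: "g summable_on Sigma UNIV W"
      by (intro abs_summable_summable[of g]) simp
    have "(g has_sum L ((cmod z)\<^sup>2)) (Sigma UNIV W)"
    proof (rule has_sum_SigmaI[OF _ _ gs])
      fix k :: nat
      have "(\<Sum>xs\<in>W k. g (k, xs)) = c k * ((cmod z)\<^sup>2 - x\<^sub>0) ^ k"
        using sum_over_words[OF finS, of v k] vS by (simp add: W_def g_def flip: sum_distrib_left)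
      then show "((\<lambda>xs. g (k, xs)) has_sum c k * ((cmod z)\<^sup>2 - x\<^sub>0) ^ k) (W k)"
        using has_sum_finite[OF finW] by metis
    next
      have "\<bar>(cmod z)\<^sup>2 - x\<^sub>0\<bar> < \<rho>"
        using sum_abs[of v S] absv vS by linarith
      then show "((\<lambda>k. c k * ((cmod z)\<^sup>2 - x\<^sub>0) ^ k) has_sum L ((cmod z)\<^sup>2)) UNIV"
        by (intro norm_summable_imp_has_sum c) (use abs_c in auto)
    qed
    moreover have "bij_betw (\<lambda>xs. (length xs, xs)) I (Sigma UNIV W)"
      by (rule bij_betwI[of _ _ _ snd]) (auto simp: I_def W_def)
    ultimately have "((\<lambda>xs. g (length xs, xs)) has_sum L ((cmod z)\<^sup>2)) I"
      by (simp add: has_sum_reindex_bij_betw[where f = g and g = "\<lambda>xs. (length xs, xs)"])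
    moreover have "prod_list (map v xs) = prod_list (map fst xs) * s ^ e xs * t ^ f xs" for xs
      by (induction xs) (auto simp: e_def f_def v_def power_add)
    then have "g (length xs, xs) = C xs * (Re z - Re p) ^ e xs * (Im z - Im p) ^ f xs" for xs
      by (simp add: g_def C_def s_def t_def)
    ultimately show ?thesis by simp
  qed
  from monomial_family_regroup[OF this] r(1)
  show "\<exists>r>0. \<exists>a. \<forall>z\<in>ball p r.
     ((\<lambda>(j, k). a j k * (Re z - Re p) ^ j * (Im z - Im p) ^ k) has_sum L ((cmod z)\<^sup>2)) UNIV"
    by (intro exI[of _ r] conjI exI[of _ "\<lambda>j k. \<Sum>\<^sub>\<infinity>i\<in>{i \<in> I. e i = j \<and> f i = k}. C i"] ballI)
qed

section \<open>The Laplacian of a harmonic plus a radial function\<close>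

lemma wirtinger_eqI:
  assumes "(F has_derivative (\<lambda>h. a * h + b * cnj h)) (at z)"
  shows "wirtinger F z = a" "wirtinger_bar F z = b"
  using frechet_derivative_at[OF assms, symmetric]
  by (simp_all add: wirtinger_def wirtinger_bar_def algebra_simps)

lemma ddbar_eqI:
  assumes S: "open S" "z \<in> S"
    and F: "\<And>v. v \<in> S \<Longrightarrow>
      ((\<lambda>u. complex_of_real (F u)) has_derivative (\<lambda>h. p v * h + q v * cnj h)) (at v)"
    and q: "(q has_derivative (\<lambda>h. a * h + b * cnj h)) (at z)"
  shows "ddbar F z = a"
proof -
  have "(wirtinger_bar (\<lambda>u. complex_of_real (F u)) has_derivative (\<lambda>h. a * h + b * cnj h)) (at z)"
    by (rule has_derivative_transform_within_open[OF q S]) (simp add: wirtinger_eqI(2)[OF F])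
  then show ?thesis unfolding ddbar_def by (rule wirtinger_eqI(1))
qed

lemma has_derivative_radial:
  assumes "(\<phi> has_real_derivative d) (at ((cmod v)\<^sup>2))"
  shows "((\<lambda>u. complex_of_real (\<phi> ((cmod u)\<^sup>2))) has_derivative
           (\<lambda>h. complex_of_real d * cnj v * h + complex_of_real d * v * cnj h)) (at v)"
proof -
  have "((\<lambda>u. (cmod u)\<^sup>2) has_derivative (\<lambda>h. 2 * (Re v * Re h + Im v * Im h))) (at v)"
    unfolding cmod_power2 by (auto intro!: derivative_eq_intros)
  from has_derivative_compose[OF this assms[unfolded has_field_derivative_def]]
  have "((\<lambda>u. complex_of_real (\<phi> ((cmod u)\<^sup>2))) has_derivative
      (\<lambda>h. complex_of_real (d * (2 * (Re v * Re h + Im v * Im h))))) (at v)"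
    by (intro has_derivative_of_real)
  then show ?thesis
    by (rule has_derivative_eq_rhs) (simp add: fun_eq_iff complex_eq_iff algebra_simps)
qed

text \<open>The harmonic part covers both the factor by which two holomorphic sections of the kernel
  bundle differ, and additive constants. Its derivative in the conjugate direction is antiholomorphic,
  hence killed by the second derivative.\<close>

lemma ddbar_harmonic_plus_radial:
  assumes g: "g holomorphic_on ball 0 1"
    and F: "\<And>u. u \<in> ball 0 1 \<Longrightarrow> F u = 2 * Re (g u) + \<phi> ((cmod u)\<^sup>2)"
    and \<phi>: "\<And>x. 0 \<le> x \<Longrightarrow> x < 1 \<Longrightarrow> (\<phi> has_real_derivative \<phi>' x) (at x)"
    and \<phi>': "\<And>x. 0 \<le> x \<Longrightarrow> x < 1 \<Longrightarrow> (\<phi>' has_real_derivative \<phi>'' x) (at x)"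
    and z: "z \<in> ball 0 1"
  shows "ddbar F z = complex_of_real (\<phi>' ((cmod z)\<^sup>2) + (cmod z)\<^sup>2 * \<phi>'' ((cmod z)\<^sup>2))"
proof (rule ddbar_eqI[OF open_ball z])
  have sq: "0 \<le> (cmod v)\<^sup>2" "(cmod v)\<^sup>2 < 1" if "v \<in> ball 0 1" for v
    using that by (auto simp: power_less_one_iff)
  fix v :: complex assume v: "v \<in> ball 0 1"
  have g': "(g has_derivative (\<lambda>h. deriv g v * h)) (at v)"
    using holomorphic_derivI[OF g open_ball v] by (simp add: has_field_derivative_def)
  have "((\<lambda>u. g u + cnj (g u) + complex_of_real (\<phi> ((cmod u)\<^sup>2))) has_derivative
      (\<lambda>h. deriv g v * h + cnj (deriv g v * h) +
        (complex_of_real (\<phi>' ((cmod v)\<^sup>2)) * cnj v * h + complex_of_real (\<phi>' ((cmod v)\<^sup>2)) * v * cnj h))) (at v)"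
    by (intro has_derivative_add has_derivative_cnj g' has_derivative_radial \<phi> sq v)
  then have "((\<lambda>u. g u + cnj (g u) + complex_of_real (\<phi> ((cmod u)\<^sup>2))) has_derivative
      (\<lambda>h. (deriv g v + complex_of_real (\<phi>' ((cmod v)\<^sup>2)) * cnj v) * h +
        (cnj (deriv g v) + complex_of_real (\<phi>' ((cmod v)\<^sup>2)) * v) * cnj h)) (at v)"
    by (rule has_derivative_eq_rhs) (simp add: fun_eq_iff algebra_simps)
  then show "((\<lambda>u. complex_of_real (F u)) has_derivative
      (\<lambda>h. (deriv g v + complex_of_real (\<phi>' ((cmod v)\<^sup>2)) * cnj v) * h +
        (cnj (deriv g v) + complex_of_real (\<phi>' ((cmod v)\<^sup>2)) * v) * cnj h)) (at v)"
    by (rule has_derivative_transform_within_open[OF _ open_ball v])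
       (simp add: F complex_eq_iff)
next
  define x where "x = (cmod z)\<^sup>2"
  have x: "0 \<le> x" "x < 1" using z by (auto simp: x_def power_less_one_iff)
  have "(deriv g has_derivative (\<lambda>h. deriv (deriv g) z * h)) (at z)"
    using holomorphic_derivI[OF holomorphic_deriv[OF g open_ball] open_ball z]
    by (simp add: has_field_derivative_def)
  then have "((\<lambda>v. cnj (deriv g v) + complex_of_real (\<phi>' ((cmod v)\<^sup>2)) * v) has_derivative
      (\<lambda>h. cnj (deriv (deriv g) z * h) + (complex_of_real (\<phi>' ((cmod z)\<^sup>2)) * h
         + (complex_of_real (\<phi>'' x) * cnj z * h + complex_of_real (\<phi>'' x) * z * cnj h) * z))) (at z)"
    using \<phi>'[OF x] unfolding x_def
    by (intro has_derivative_add has_derivative_cnj has_derivative_mult has_derivative_radial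
          has_derivative_ident)
  then show "((\<lambda>v. cnj (deriv g v) + complex_of_real (\<phi>' ((cmod v)\<^sup>2)) * v) has_derivative
      (\<lambda>h. complex_of_real (\<phi>' ((cmod z)\<^sup>2) + (cmod z)\<^sup>2 * \<phi>'' ((cmod z)\<^sup>2)) * h
         + (cnj (deriv (deriv g) z) + complex_of_real (\<phi>'' x) * z\<^sup>2) * cnj h)) (at z)"
  proof (rule has_derivative_eq_rhs)
    have "complex_of_real ((cmod z)\<^sup>2) = z * cnj z" by (rule complex_norm_square)
    then show "(\<lambda>h. cnj (deriv (deriv g) z * h) + (complex_of_real (\<phi>' ((cmod z)\<^sup>2)) * h
         + (complex_of_real (\<phi>'' x) * cnj z * h + complex_of_real (\<phi>'' x) * z * cnj h) * z)) =
      (\<lambda>h. complex_of_real (\<phi>' ((cmod z)\<^sup>2) + (cmod z)\<^sup>2 * \<phi>'' ((cmod z)\<^sup>2)) * h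
         + (cnj (deriv (deriv g) z) + complex_of_real (\<phi>'' x) * z\<^sup>2) * cnj h)"
      unfolding of_real_add of_real_mult
      by (simp add: fun_eq_iff x_def power2_eq_square algebra_simps)
  qed
qed

section \<open>Power series with nonnegative coefficients\<close>

text \<open>Summation by parts: multiplication with the decreasing sequence of powers preserves the
  domination of partial sums, even when single coefficients are not dominated.\<close>

lemma power_series_le_of_partial_sums_le:
  fixes a c :: "nat \<Rightarrow> real"
  assumes le: "\<And>N. (\<Sum>i<N. a i) \<le> (\<Sum>i<N. c i)"
    and x: "0 \<le> x" "x \<le> 1"
    and s: "summable (\<lambda>i. a i * x ^ i)" "summable (\<lambda>i. c i * x ^ i)"
  shows "(\<Sum>i. a i * x ^ i) \<le> (\<Sum>i. c i * x ^ i)"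
proof (rule LIMSEQ_le[OF summable_LIMSEQ[OF s(1)] summable_LIMSEQ[OF s(2)]], intro exI allI impI)
  fix N :: nat
  define D where "D N = (\<Sum>i<N. c i - a i)" for N
  have D: "D N \<ge> 0" for N using le[of N] by (simp add: D_def sum_subtractf)
  have "(\<Sum>i<N. (c i - a i) * x ^ i) \<ge> D N * x ^ N"
  proof (induction N)
    case (Suc N)
    have "D (Suc N) * x ^ Suc N \<le> D (Suc N) * x ^ N"
      using D x by (intro mult_left_mono) (auto simp: mult_left_le_one_le)
    also have "\<dots> = D N * x ^ N + (c N - a N) * x ^ N" by (simp add: D_def algebra_simps)
    finally show ?case using Suc.IH by simp
  qed (simp add: D_def)
  moreover have "D N * x ^ N \<ge> 0" using D x by simp
  ultimately show "(\<Sum>i<N. a i * x ^ i) \<le> (\<Sum>i<N. c i * x ^ i)"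
    by (simp add: left_diff_distrib sum_subtractf)
qed

lemma summable_polynomial_times_power:
  fixes x :: real
  assumes "\<bar>x\<bar> < 1"
  shows "summable (\<lambda>j. (real j + 1) ^ d * x ^ j)"
  using assms
proof (induction d arbitrary: x)
  case 0
  then show ?case by (simp add: summable_geometric)
next
  case (Suc d)
  have "summable (\<lambda>j. diffs (\<lambda>j. (real j + 1) ^ d) j * \<bar>x\<bar> ^ j)"
    by (rule termdiff_converges[of "\<bar>x\<bar>" 1]) (use Suc in auto)
  then show ?case
  proof (rule summable_comparison_test'[of _ 0])
    fix j :: nat
    have "(real j + 1) ^ d \<le> (real (Suc j) + 1) ^ d" by (intro power_mono) auto
    then have "(real j + 1) * (real j + 1) ^ d * \<bar>x\<bar> ^ j \<le> real (Suc j) * (real (Suc j) + 1) ^ d * \<bar>x\<bar> ^ j"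
      by (intro mult_right_mono mult_mono) auto
    then show "norm ((real j + 1) ^ Suc d * x ^ j) \<le> diffs (\<lambda>j. (real j + 1) ^ d) j * \<bar>x\<bar> ^ j"
      by (simp add: diffs_def abs_mult power_abs)
  qed
qed

lemma ln_power_series_derivatives:
  fixes b :: "nat \<Rightarrow> real"
  assumes b: "\<And>j. b j \<ge> 0" "b 0 > 0"
    and s: "\<And>x. \<bar>x\<bar> < 1 \<Longrightarrow> summable (\<lambda>j. b j * x ^ j)"
  obtains \<phi>' \<phi>'' where
    "\<And>x. 0 \<le> x \<Longrightarrow> x < 1 \<Longrightarrow> ((\<lambda>x. ln (\<Sum>j. b j * x ^ j)) has_real_derivative \<phi>' x) (at x)"
    "\<And>x. 0 \<le> x \<Longrightarrow> x < 1 \<Longrightarrow> (\<phi>' has_real_derivative \<phi>'' x) (at x)"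
proof -
  define A where "A c x = (\<Sum>j. c j * x ^ j)" for c :: "nat \<Rightarrow> real" and x :: real
  have s': "summable (\<lambda>j. diffs b j * x ^ j)" if "\<bar>x\<bar> < 1" for x
    using termdiff_converges[of x 1 b] s that by simp
  have D: "(A b has_real_derivative A (diffs b) x) (at x)"
    "(A (diffs b) has_real_derivative A (diffs (diffs b)) x) (at x)" if "\<bar>x\<bar> < 1" for x
    using termdiffs_strong'[of 1 b x] termdiffs_strong'[of 1 "diffs b" x] s s' that
    by (simp_all add: A_def [abs_def])
  have pos: "A b x > 0" if "0 \<le> x" "x < 1" for x
  proof -
    have "(\<Sum>j<1. b j * x ^ j) \<le> A b x"
      unfolding A_def by (rule sum_le_suminf) (use that b s in auto)
    with b show ?thesis by simp
  qed
  show thesis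
  proof (rule that[where \<phi>' = "\<lambda>x. A (diffs b) x / A b x"
        and \<phi>'' = "\<lambda>x. (A (diffs (diffs b)) x * A b x - A (diffs b) x * A (diffs b) x) / (A b x * A b x)"])
    fix x :: real assume x: "0 \<le> x" "x < 1"
    show "((\<lambda>x. ln (\<Sum>j. b j * x ^ j)) has_real_derivative A (diffs b) x / A b x) (at x)"
      using DERIV_chain2[where f = ln, OF DERIV_ln_divide[OF pos[OF x]] D(1)[of x]] x
      by (simp add: A_def)
    show "((\<lambda>x. A (diffs b) x / A b x) has_real_derivative
       (A (diffs (diffs b)) x * A b x - A (diffs b) x * A (diffs b) x) / (A b x * A b x)) (at x)"
      using x pos[OF x] by (intro DERIV_divide D) auto
  qed
qed

lemma Re_holomorphic_power_series:
  assumes "r > 0" and f: "f holomorphic_on ball (complex_of_real x\<^sub>0) r"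
  shows "\<exists>\<rho>>0. \<exists>c. \<forall>x. \<bar>x - x\<^sub>0\<bar> < \<rho> \<longrightarrow>
           (\<lambda>k. c k * (x - x\<^sub>0) ^ k) sums Re (f (complex_of_real x))"
proof (intro exI conjI allI impI)
  let ?c = "\<lambda>k. Re ((deriv ^^ k) f (complex_of_real x\<^sub>0) / fact k)"
  fix x assume "\<bar>x - x\<^sub>0\<bar> < r"
  then have "complex_of_real x \<in> ball (complex_of_real x\<^sub>0) r"
    by (simp add: dist_norm abs_minus_commute flip: of_real_diff)
  then have "(\<lambda>k. Re ((deriv ^^ k) f (complex_of_real x\<^sub>0) / fact k *
      (complex_of_real x - complex_of_real x\<^sub>0) ^ k)) sums Re (f (complex_of_real x))"
    by (intro sums_Re holomorphic_power_series[OF f])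
  moreover have "Re (a * (complex_of_real x - complex_of_real x\<^sub>0) ^ k) = Re a * (x - x\<^sub>0) ^ k" for a k
  proof -
    have "(complex_of_real x - complex_of_real x\<^sub>0) ^ k = complex_of_real ((x - x\<^sub>0) ^ k)" by simp
    then show ?thesis by (simp del: of_real_power of_real_diff)
  qed
  ultimately show "(\<lambda>k. ?c k * (x - x\<^sub>0) ^ k) sums Re (f (complex_of_real x))"
    by (simp only:)
qed (rule assms)

text \<open>The sum of the series is positive on [0,1), so it has positive real part in a complex
  neighbourhood, where the principal logarithm applies.\<close>

lemma ln_power_series_holomorphic:
  fixes b :: "nat \<Rightarrow> real"
  assumes b: "\<And>j. b j \<ge> 0" "b 0 > 0"
    and s: "\<And>z::complex. cmod z < 1 \<Longrightarrow> summable (\<lambda>j. complex_of_real (b j) * z ^ j)"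
    and x: "0 \<le> x\<^sub>0" "x\<^sub>0 < 1"
  obtains r f where "r > 0" "f holomorphic_on ball (complex_of_real x\<^sub>0) r"
    "\<And>x. \<bar>x - x\<^sub>0\<bar> < r \<Longrightarrow> Re (f (complex_of_real x)) = ln (\<Sum>j. b j * x ^ j)"
proof -
  define A where "A z = (\<Sum>j. complex_of_real (b j) * z ^ j)" for z
  define a where "a x = (\<Sum>j. b j * x ^ j)" for x
  have sr: "summable (\<lambda>j. b j * x ^ j)" if "\<bar>x\<bar> < 1" for x
    using summable_Re[OF s[of "complex_of_real x"]] that by (simp flip: of_real_power)
  have Aa: "A (complex_of_real x) = complex_of_real (a x)" if "\<bar>x\<bar> < 1" for x
    using suminf_of_real[OF sr[OF that], where 'a = complex] by (simp add: A_def a_def)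
  have holA: "A holomorphic_on ball 0 1"
    unfolding holomorphic_on_open[OF open_ball]
  proof (intro ballI exI)
    fix z :: complex assume "z \<in> ball 0 1"
    then show "(A has_field_derivative (\<Sum>n. diffs (\<lambda>j. complex_of_real (b j)) n * z ^ n)) (at z)"
      using termdiffs_strong'[of 1 "\<lambda>j. complex_of_real (b j)" z, OF s] by (simp add: A_def[abs_def])
  qed
  have "(\<Sum>j<1. b j * x\<^sub>0 ^ j) \<le> a x\<^sub>0"
    unfolding a_def by (rule sum_le_suminf) (use x b sr in auto)
  with b have pos: "a x\<^sub>0 > 0" by simp
  have "open ({z. Re z > 0} :: complex set)"
    by (rule open_halfspace_Re_gt)
  then have "open (A -` {z. Re z > 0} \<inter> ball 0 1)"
    by (subst Int_commute)
       (rule continuous_open_preimage[OF holomorphic_on_imp_continuous_on[OF holA] open_ball])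
  moreover have "complex_of_real x\<^sub>0 \<in> A -` {z. Re z > 0} \<inter> ball 0 1"
    using pos Aa[of x\<^sub>0] x by simp
  ultimately obtain r where r: "r > 0" "ball (complex_of_real x\<^sub>0) r \<subseteq> A -` {z. Re z > 0} \<inter> ball 0 1"
    by (meson open_contains_ball)
  show thesis
  proof (rule that[OF r(1), of "\<lambda>z. Ln (A z)"])
    show "(\<lambda>z. Ln (A z)) holomorphic_on ball (complex_of_real x\<^sub>0) r"
      using r(2) by (intro holomorphic_on_Ln' holomorphic_on_subset[OF holA])
        (auto simp: complex_nonpos_Reals_iff subset_iff)
    fix x assume "\<bar>x - x\<^sub>0\<bar> < r"
    then have "complex_of_real x \<in> ball (complex_of_real x\<^sub>0) r"
      by (simp add: dist_norm abs_minus_commute flip: of_real_diff)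
    with r(2) have "complex_of_real x \<in> A -` {z. Re z > 0} \<inter> ball 0 1" by blast
    then have *: "Re (A (complex_of_real x)) > 0" "\<bar>x\<bar> < 1" by auto
    then show "Re (Ln (A (complex_of_real x))) = ln (\<Sum>j. b j * x ^ j)"
      using Aa[OF *(2)] by (simp add: Ln_of_real a_def)
  qed
qed

lemma real_analytic_on_ln_power_series_diff:
  fixes a b :: "nat \<Rightarrow> real"
  assumes a: "\<And>j. a j \<ge> 0" "a 0 > 0" and b: "\<And>j. b j \<ge> 0" "b 0 > 0"
    and sa: "\<And>x. \<bar>x\<bar> < 1 \<Longrightarrow> summable (\<lambda>j. a j * \<bar>x\<bar> ^ j)"
    and sb: "\<And>x. \<bar>x\<bar> < 1 \<Longrightarrow> summable (\<lambda>j. b j * \<bar>x\<bar> ^ j)"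
  shows "real_analytic_on
    (\<lambda>u. ln (\<Sum>j. a j * ((cmod u)\<^sup>2) ^ j) - ln (\<Sum>j. b j * ((cmod u)\<^sup>2) ^ j) + c) (ball 0 1)"
proof (rule real_analytic_on_radial[where
      L = "\<lambda>x. ln (\<Sum>j. a j * x ^ j) - ln (\<Sum>j. b j * x ^ j) + c"])
  have ca: "summable (\<lambda>j. complex_of_real (a j) * z ^ j)" if "cmod z < 1" for z
    by (rule summable_norm_cancel) (use sa[of "cmod z"] a that in \<open>simp add: norm_mult norm_power\<close>)
  have cb: "summable (\<lambda>j. complex_of_real (b j) * z ^ j)" if "cmod z < 1" for z
    by (rule summable_norm_cancel) (use sb[of "cmod z"] b that in \<open>simp add: norm_mult norm_power\<close>)
  fix x\<^sub>0 :: real assume x\<^sub>0: "0 \<le> x\<^sub>0" "x\<^sub>0 < 1"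
  obtain r f where f: "r > 0" "f holomorphic_on ball (complex_of_real x\<^sub>0) r"
    "\<And>x. \<bar>x - x\<^sub>0\<bar> < r \<Longrightarrow> Re (f (complex_of_real x)) = ln (\<Sum>j. a j * x ^ j)"
    by (rule ln_power_series_holomorphic[OF a ca x\<^sub>0], assumption, rule that)
  obtain s g where g: "s > 0" "g holomorphic_on ball (complex_of_real x\<^sub>0) s"
    "\<And>x. \<bar>x - x\<^sub>0\<bar> < s \<Longrightarrow> Re (g (complex_of_real x)) = ln (\<Sum>j. b j * x ^ j)"
    by (rule ln_power_series_holomorphic[OF b cb x\<^sub>0], assumption, rule that)
  have "(\<lambda>z. f z - g z + complex_of_real c) holomorphic_on ball (complex_of_real x\<^sub>0) (min r s)"
    by (intro holomorphic_intros holomorphic_on_subset[OF f(2)] holomorphic_on_subset[OF g(2)]) auto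
  from Re_holomorphic_power_series[OF _ this] f(1) g(1) obtain \<rho> p where \<rho>: "\<rho> > 0"
    "\<And>x. \<bar>x - x\<^sub>0\<bar> < \<rho> \<Longrightarrow> (\<lambda>k. p k * (x - x\<^sub>0) ^ k) sums
       Re (f (complex_of_real x) - g (complex_of_real x) + complex_of_real c)"
    by auto
  show "\<exists>\<rho>>0. \<exists>p. \<forall>x. \<bar>x - x\<^sub>0\<bar> < \<rho> \<longrightarrow> (\<lambda>k. p k * (x - x\<^sub>0) ^ k) sums
      (ln (\<Sum>j. a j * x ^ j) - ln (\<Sum>j. b j * x ^ j) + c)"
  proof (intro exI conjI allI impI)
    show "min \<rho> (min r s) > 0" using \<rho>(1) f(1) g(1) by simp
    fix x assume "\<bar>x - x\<^sub>0\<bar> < min \<rho> (min r s)"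
    then show "(\<lambda>k. p k * (x - x\<^sub>0) ^ k) sums (ln (\<Sum>j. a j * x ^ j) - ln (\<Sum>j. b j * x ^ j) + c)"
      using \<rho>(2)[of x] f(3)[of x] g(3)[of x] by simp
  qed
qed

section \<open>Approximation and separability in weighted Hardy spaces\<close>

text \<open>The distance from a vector to one of finite support, with head and tail estimated
  separately; all density arguments below use it.\<close>

lemma H2_approxI:
  assumes w: "\<And>j. w j > 0" and f: "f \<in> hcar (H2 w)"
    and g: "\<And>j. j \<ge> N \<Longrightarrow> fps_nth g j = 0"
    and a: "(\<Sum>j<N. (cmod (fps_nth (f - g) j))\<^sup>2 * w j) \<le> a"
    and b: "(\<Sum>j. (cmod (fps_nth f (j + N)))\<^sup>2 * w (j + N)) \<le> b"
    and c: "a + b \<le> c\<^sup>2" "c \<ge> 0"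
  shows "hnorm (H2 w) (f - g) \<le> c"
proof (rule H2_normI(2)[OF w c(2)])
  fix M
  let ?h = "\<lambda>j. (cmod (fps_nth (f - g) j))\<^sup>2 * w j"
  have s: "summable (\<lambda>j. (cmod (fps_nth f (j + N)))\<^sup>2 * w (j + N))"
    using f by (subst summable_iff_shift) (simp add: H2_def)
  have "(\<Sum>j<M. ?h j) \<le> (\<Sum>j<N + M. ?h j)"
    by (rule sum_mono2) (auto simp: w less_imp_le)
  also have "\<dots> = (\<Sum>j<N. ?h j) + (\<Sum>j<M. ?h (j + N))"
    by (induction M) (simp_all add: add.commute)
  also have "(\<Sum>j<M. ?h (j + N)) = (\<Sum>j<M. (cmod (fps_nth f (j + N)))\<^sup>2 * w (j + N))"
    by (simp add: g)
  also have "\<dots> \<le> b"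
    by (rule order_trans[OF sum_le_suminf[OF s] b]) (auto simp: w less_imp_le)
  finally show "(\<Sum>j<M. ?h j) \<le> c\<^sup>2" using a c(1) by linarith
qed

lemma H2_tail:
  assumes f: "f \<in> hcar (H2 w)" and e: "e > 0"
  obtains N where "(\<Sum>j. (cmod (fps_nth f (j + N)))\<^sup>2 * w (j + N)) \<le> e"
proof -
  have "summable (\<lambda>j. (cmod (fps_nth f j))\<^sup>2 * w j)" using f by (simp add: H2_def)
  from suminf_exist_split[OF e this] obtain N where
    "norm (\<Sum>j. (cmod (fps_nth f (j + N)))\<^sup>2 * w (j + N)) < e" by blast
  then show thesis by (intro that[of N]) auto
qed

lemma hnorm_H2_scale:
  assumes w: "\<And>j. w j > 0" and f: "f \<in> hcar (H2 w)"
  shows "hnorm (H2 w) (fps_const c * f) = cmod c * hnorm (H2 w) f"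
proof -
  have s: "summable (\<lambda>j. (cmod (fps_nth f j))\<^sup>2 * w j)" using f by (simp add: H2_def)
  have "(hnorm (H2 w) (fps_const c * f))\<^sup>2 = (cmod c * hnorm (H2 w) f)\<^sup>2"
    by (simp add: H2_norm_sq[OF w f] H2_norm_sq[OF w H2_scale[OF f]] power_mult_distrib norm_mult
          suminf_mult[OF s] mult.assoc)
  then show ?thesis
    by (rule power2_eq_imp_eq) (simp_all add: hnorm_H2_nonneg[OF w] f H2_scale)
qed

lemma H2_finite_support:
  assumes "\<And>j. j \<ge> N \<Longrightarrow> fps_nth g j = 0"
  shows "g \<in> hcar (H2 w)"
  unfolding H2_def using assms by (auto intro!: summable_finite[of "{..<N}"]) (meson not_le)

lemma vector_space_fps: "vector_space (\<lambda>c f. fps_const c * (f :: complex fps))"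
  by standard (simp_all add: algebra_simps flip: fps_const_mult fps_const_add)

lemma hscale_H2: "hscale (H2 w) = (\<lambda>c f. fps_const c * f)"
  by (simp add: H2_def)

lemma separable_space_H2:
  assumes w: "\<And>j. w j > 0"
  shows "separable_space (htopology (H2 w))"
proof -
  interpret Metric_space "hcar (H2 w)" "hdist (H2 w)" by (rule Metric_space_H2[OF w])
  obtain D :: "complex set" where D: "countable D"
    and dense: "\<And>X. open X \<Longrightarrow> X \<noteq> {} \<Longrightarrow> \<exists>d\<in>D. d \<in> X"
    using countable_dense_exists by blast
  define P where "P xs = Abs_fps (\<lambda>j. if j < length xs then xs ! j else 0)" for xs :: "complex list"
  have P: "P xs \<in> hcar (H2 w)" for xs
    by (rule H2_finite_support[of "length xs"]) (simp add: P_def)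
  have "\<exists>g\<in>P ` lists D. g \<in> mball f e" if f: "f \<in> hcar (H2 w)" and e: "e > 0" for f e
  proof -
    obtain N where N: "(\<Sum>j. (cmod (fps_nth f (j + N)))\<^sup>2 * w (j + N)) \<le> (e / 2)\<^sup>2 / 2"
      using H2_tail[OF f, of "(e / 2)\<^sup>2 / 2"] e by auto
    define \<epsilon> where "\<epsilon> = (e / 2)\<^sup>2 / (2 * (real N + 1))"
    have \<epsilon>: "\<epsilon> > 0" using e by (simp add: \<epsilon>_def)
    have "\<exists>q\<in>D. (cmod (fps_nth f j - q))\<^sup>2 * w j < \<epsilon>" for j
    proof -
      have "open {q. (cmod (fps_nth f j - q))\<^sup>2 * w j < \<epsilon>}"
        by (intro open_Collect_less continuous_intros)
      moreover have "fps_nth f j \<in> {q. (cmod (fps_nth f j - q))\<^sup>2 * w j < \<epsilon>}" using \<epsilon> by simp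
      ultimately show ?thesis using dense by blast
    qed
    then obtain q where q: "\<And>j. q j \<in> D" "\<And>j. (cmod (fps_nth f j - q j))\<^sup>2 * w j < \<epsilon>" by metis
    define g where "g = P (map q [0..<N])"
    have "hnorm (H2 w) (f - g) \<le> e / 2"
    proof (rule H2_approxI[OF w f _ _ N])
      have "(\<Sum>j<N. (cmod (fps_nth (f - g) j))\<^sup>2 * w j) \<le> (\<Sum>j<N. \<epsilon>)"
        using q(2) by (intro sum_mono) (auto simp: g_def P_def less_imp_le)
      also have "\<dots> = real N * \<epsilon>" by simp
      finally show "(\<Sum>j<N. (cmod (fps_nth (f - g) j))\<^sup>2 * w j) \<le> real N * \<epsilon>" .
      have "real N * \<epsilon> \<le> (e / 2)\<^sup>2 / 2" by (simp add: \<epsilon>_def divide_simps) (simp add: algebra_simps)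
      then show "real N * \<epsilon> + (e / 2)\<^sup>2 / 2 \<le> (e / 2)\<^sup>2" by (simp add: field_simps)
    qed (use e in \<open>auto simp: g_def P_def\<close>)
    then have "hdist (H2 w) f g < e" using e by (simp add: hdist_def f P g_def)
    moreover have "g \<in> P ` lists D" using q(1) unfolding g_def by (intro imageI) (auto simp: in_lists_conv_set)
    ultimately show ?thesis using f P by (intro bexI[of _ g]) (auto simp: g_def)
  qed
  then have "mtopology closure_of (P ` lists D) = hcar (H2 w)"
    by (auto simp: metric_closure_of)
  moreover have "countable (P ` lists D)" using D by (intro countable_image countable_lists)
  moreover have "P ` lists D \<subseteq> hcar (H2 w)" using P by auto
  ultimately show ?thesis
    unfolding separable_space_def htopology_def by (intro exI[of _ "P ` lists D"]) auto
qed

section \<open>Tame weights and the Cowen-Douglas class\<close>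

text \<open>The filter that isolates single coefficients of the eigenvectors below.\<close>

lemma root_of_unity_power_sum:
  assumes "N > 0"
  shows "(\<Sum>m<N. exp (2 * of_real pi * \<i> / of_nat N) ^ (m * i)) = (if N dvd i then of_nat N else (0::complex))"
proof -
  define \<omega> where "\<omega> = exp (2 * of_real pi * \<i> / of_nat N :: complex)"
  have eq: "\<omega> ^ i = exp (2 * of_real pi * \<i> * of_nat i / of_nat N)" for i
    by (simp add: \<omega>_def mult_ac flip: exp_of_nat_mult)
  have one: "\<omega> ^ i = 1 \<longleftrightarrow> N dvd i" for i
    using complex_root_unity_eq[where n = N and j = i and k = 0] assms by (simp add: eq dvd_eq_mod_eq_0)
  have "(\<Sum>m<N. \<omega> ^ (m * i)) = (\<Sum>m<N. (\<omega> ^ i) ^ m)"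
    by (simp add: mult.commute flip: power_mult)
  also have "\<dots> = (if N dvd i then of_nat N else 0)"
  proof (cases "N dvd i")
    case False
    have "(\<omega> ^ i) ^ N = 1" using one[of "i * N"] by (simp add: power_mult)
    with False one show ?thesis by (simp add: geometric_sum)
  next
    case True
    then have "\<omega> ^ i = 1" using one by blast
    with True show ?thesis by simp
  qed
  finally show ?thesis by (simp add: \<omega>_def)
qed

text \<open>Also the kernel function of the space at the conjugate point; the normalization is such
  that the dependence on \<open>u\<close> is holomorphic.\<close>

definition eigenvector :: "(nat \<Rightarrow> real) \<Rightarrow> complex \<Rightarrow> complex fps" where
  "eigenvector w u = Abs_fps (\<lambda>j. u ^ j / complex_of_real (w j))"

text \<open>The last condition says that the iterates of the right inverse of the backward shift grow at
  most polynomially, which controls the lower spectral radius of the shift uniformly in the position. The value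
  at \<open>j = 0\<close> already bounds the reciprocals of the weights polynomially.\<close>

locale tame_weight =
  fixes w :: "nat \<Rightarrow> real" and C K W :: real and d :: nat
  assumes pos: "w j > 0"
    and step: "w (Suc j) \<le> C * w j"
    and upper: "w j \<le> W"
    and decay: "w j \<le> K * (real l + 1) ^ d * w (j + l)"
begin

lemma K_pos: "K > 0"
  using decay[of 0 0] pos[of 0] by (simp add: zero_less_mult_iff[of K] less_le_trans)

lemma C_pos: "C > 0"
  using step[of 0] pos[of 0] pos[of 1] by (smt (verit) One_nat_def mult_nonpos_nonneg)

lemma inverse_le: "1 / w l \<le> K / w 0 * (real l + 1) ^ d"
  using decay[of 0 l] pos[of 0] pos[of l] by (simp add: field_simps)

lemma summable_power_div_weight:
  fixes x :: real
  assumes "\<bar>x\<bar> < 1"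
  shows "summable (\<lambda>j. 1 / w j * x ^ j)" "summable (\<lambda>j. 1 / w j * \<bar>x\<bar> ^ j)"
proof -
  have s: "summable (\<lambda>j. K / w 0 * ((real j + 1) ^ d * \<bar>x\<bar> ^ j))"
    using assms by (intro summable_mult summable_polynomial_times_power) simp
  have le: "1 / w j * \<bar>x\<bar> ^ j \<le> K / w 0 * ((real j + 1) ^ d * \<bar>x\<bar> ^ j)" for j
    using mult_right_mono[OF inverse_le[of j], of "\<bar>x\<bar> ^ j"] by (simp add: mult.assoc)
  show *: "summable (\<lambda>j. 1 / w j * \<bar>x\<bar> ^ j)"
    by (rule summable_comparison_test'[OF s, of 0])
       (use le pos in \<open>simp add: less_imp_le abs_mult power_abs\<close>)
  show "summable (\<lambda>j. 1 / w j * x ^ j)"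
    by (rule summable_norm_cancel, rule summable_comparison_test'[OF *, of 0])
       (use pos in \<open>simp add: less_imp_le abs_mult power_abs\<close>)
qed

lemma admissible: "admissible_weight w"
proof -
  define c where "c = w 0 / (K * 2 ^ d)"
  have c: "c > 0" using pos[of 0] K_pos by (simp add: c_def)
  have low: "c / real j ^ d \<le> w j" if "j \<ge> 1" for j
  proof -
    have "(real j + 1) ^ d \<le> (2 * real j) ^ d" using that by (intro power_mono) auto
    then have "K * (real j + 1) ^ d * w j \<le> K * (2 * real j) ^ d * w j"
      using K_pos pos[of j] by (intro mult_right_mono mult_left_mono) auto
    then have "w 0 \<le> K * (2 * real j) ^ d * w j" using decay[of 0 j] by simp
    then show ?thesis using that K_pos by (simp add: c_def field_simps power_mult_distrib)
  qed
  have "(\<lambda>j. root j (w j)) \<longlonglongrightarrow> 1"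
  proof (rule tendsto_sandwich)
    show "\<forall>\<^sub>F j in sequentially. root j c / (root j (real j)) ^ d \<le> root j (w j)"
    proof (rule eventually_sequentiallyI[of 1])
      fix j :: nat assume j: "j \<ge> 1"
      then have "root j (c / real j ^ d) \<le> root j (w j)" using low[OF j] by simp
      then show "root j c / (root j (real j)) ^ d \<le> root j (w j)"
        using j by (simp add: real_root_divide real_root_power)
    qed
    show "\<forall>\<^sub>F j in sequentially. root j (w j) \<le> root j W"
      by (rule eventually_sequentiallyI[of 1]) (simp add: upper)
    have "(\<lambda>j. root j c / (root j (real j)) ^ d) \<longlonglongrightarrow> 1 / 1 ^ d"
      by (intro tendsto_intros LIMSEQ_root LIMSEQ_root_const c) simp
    then show "(\<lambda>j. root j c / (root j (real j)) ^ d) \<longlonglongrightarrow> 1" by simp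
    show "(\<lambda>j. root j W) \<longlonglongrightarrow> 1"
      using pos[of 0] upper[of 0] by (intro LIMSEQ_root_const) linarith
  qed
  then have "(\<lambda>j. ereal (root j \<bar>w j\<bar>)) \<longlonglongrightarrow> ereal 1"
    using pos by (simp add: less_imp_le)
  then have "liminf (\<lambda>j. ereal (root j \<bar>w j\<bar>)) = 1"
    by (simp add: lim_imp_Liminf one_ereal_def)
  moreover have "bdd_above (range (\<lambda>j. w (Suc j) / w j))"
    using step pos by (intro bdd_aboveI2[of _ _ C]) (simp add: divide_le_eq)
  ultimately show ?thesis using pos by (simp add: admissible_weight_def)
qed

lemmas shift_nth = backward_shift_eq[OF admissible]

lemma shift_in_carrier: "f \<in> hcar (H2 w) \<Longrightarrow> backward_shift w f \<in> hcar (H2 w)"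
  using H2_inner_adjoint(1)[OF admissible] by (simp add: shift_nth)

lemma bounded_op_shift: "bounded_op (H2 w) (H2 w) (backward_shift w)"
  unfolding bounded_op_def hscale_H2
proof (intro conjI allI ballI exI)
  fix f g assume "f \<in> hcar (H2 w)" "g \<in> hcar (H2 w)"
  then show "backward_shift w (f + g) = backward_shift w f + backward_shift w g"
    by (simp add: shift_nth H2_add[OF pos] fps_eq_iff algebra_simps)
next
  fix c f assume "f \<in> hcar (H2 w)"
  then show "backward_shift w (fps_const c * f) = fps_const c * backward_shift w f"
    by (simp add: shift_nth H2_scale fps_eq_iff)
next
  fix f assume f: "f \<in> hcar (H2 w)"
  have s: "summable (\<lambda>j. (cmod (fps_nth f j))\<^sup>2 * w j)" using f by (simp add: H2_def)
  show "hnorm (H2 w) (backward_shift w f) \<le> sqrt C * hnorm (H2 w) f"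
  proof (rule H2_normI(2)[OF pos])
    fix N
    have "(cmod (fps_nth (backward_shift w f) j))\<^sup>2 * w j \<le> C * ((cmod (fps_nth f (Suc j)))\<^sup>2 * w (Suc j))" for j
    proof -
      have "(w (Suc j) / w j)\<^sup>2 * w j \<le> C * w (Suc j)"
        using mult_right_mono[OF step[of j], of "w (Suc j)"] pos[of j] pos[of "Suc j"]
        by (simp add: power2_eq_square field_simps)
      from mult_left_mono[OF this, of "(cmod (fps_nth f (Suc j)))\<^sup>2"] show ?thesis
        by (simp add: shift_nth f norm_mult norm_divide power_mult_distrib power_divide mult_ac)
    qed
    then have "(\<Sum>j<N. (cmod (fps_nth (backward_shift w f) j))\<^sup>2 * w j)
        \<le> C * (\<Sum>j<N. (cmod (fps_nth f (Suc j)))\<^sup>2 * w (Suc j))"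
      by (simp add: sum_distrib_left sum_mono)
    also have "(\<Sum>j<N. (cmod (fps_nth f (Suc j)))\<^sup>2 * w (Suc j)) \<le> (\<Sum>j<Suc N. (cmod (fps_nth f j))\<^sup>2 * w j)"
      unfolding sum.lessThan_Suc_shift using pos[of 0] by (simp add: less_imp_le)
    also have "\<dots> \<le> (hnorm (H2 w) f)\<^sup>2"
      unfolding H2_norm_sq[OF pos f] by (rule sum_le_suminf[OF s]) (auto simp: pos less_imp_le)
    finally show "(\<Sum>j<N. (cmod (fps_nth (backward_shift w f) j))\<^sup>2 * w j) \<le> (sqrt C * hnorm (H2 w) f)\<^sup>2"
      using C_pos by (simp add: power_mult_distrib)
  qed (use C_pos hnorm_H2_nonneg[OF pos f] in simp)
qed (rule shift_in_carrier)

lemma eigenvector_in_carrier: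
  assumes "cmod u < 1"
  shows "eigenvector w u \<in> hcar (H2 w)"
    and "(hnorm (H2 w) (eigenvector w u))\<^sup>2 = (\<Sum>j. 1 / w j * ((cmod u)\<^sup>2) ^ j)"
proof -
  have *: "(cmod (fps_nth (eigenvector w u) j))\<^sup>2 * w j = 1 / w j * ((cmod u)\<^sup>2) ^ j" for j
    using pos[of j]
    by (simp add: eigenvector_def norm_divide norm_power power_divide power2_eq_square power_mult_distrib)
  have "\<bar>(cmod u)\<^sup>2\<bar> < 1" using assms by (simp add: power_less_one_iff)
  then show 1: "eigenvector w u \<in> hcar (H2 w)"
    using summable_power_div_weight(1)[of "(cmod u)\<^sup>2"] unfolding * [symmetric] by (simp add: H2_def)
  show "(hnorm (H2 w) (eigenvector w u))\<^sup>2 = (\<Sum>j. 1 / w j * ((cmod u)\<^sup>2) ^ j)"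
    unfolding H2_norm_sq[OF pos 1] * ..
qed

lemma kernel_iff:
  assumes f: "f \<in> hcar (H2 w)"
  shows "shifted_op (H2 w) (backward_shift w) u f = 0 \<longleftrightarrow>
         f = fps_const (complex_of_real (w 0) * fps_nth f 0) * eigenvector w u"
proof -
  have nz: "w j \<noteq> 0" for j using pos[of j] by simp
  have "shifted_op (H2 w) (backward_shift w) u f = 0 \<longleftrightarrow>
      (\<forall>j. complex_of_real (w (Suc j)) * fps_nth f (Suc j) = u * (complex_of_real (w j) * fps_nth f j))"
    using nz by (simp add: shifted_op_def hscale_H2 shift_nth f fps_eq_iff field_simps)
  also have "\<dots> \<longleftrightarrow> (\<forall>j. complex_of_real (w j) * fps_nth f j = u ^ j * (complex_of_real (w 0) * fps_nth f 0))"
  proof (intro iffI allI)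
    fix j assume *: "\<forall>j. complex_of_real (w (Suc j)) * fps_nth f (Suc j) = u * (complex_of_real (w j) * fps_nth f j)"
    show "complex_of_real (w j) * fps_nth f j = u ^ j * (complex_of_real (w 0) * fps_nth f 0)"
      by (induction j) (simp_all add: *)
  next
    fix j assume *: "\<forall>j. complex_of_real (w j) * fps_nth f j = u ^ j * (complex_of_real (w 0) * fps_nth f 0)"
    show "complex_of_real (w (Suc j)) * fps_nth f (Suc j) = u * (complex_of_real (w j) * fps_nth f j)"
      unfolding *[rule_format, of "Suc j"] *[rule_format, of j] by simp
  qed
  also have "\<dots> \<longleftrightarrow> f = fps_const (complex_of_real (w 0) * fps_nth f 0) * eigenvector w u"
    using nz by (simp add: fps_eq_iff eigenvector_def field_simps)
  finally show ?thesis .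
qed

lemma eigenvector_in_kernel:
  "cmod u < 1 \<Longrightarrow> shifted_op (H2 w) (backward_shift w) u (eigenvector w u) = 0"
  using pos[of 0] by (subst kernel_iff[OF eigenvector_in_carrier(1)]) (simp_all add: eigenvector_def)

lemma eigenvector_nonzero: "eigenvector w u \<noteq> 0"
proof
  assume "eigenvector w u = 0"
  then have "fps_nth (eigenvector w u) 0 = 0" by simp
  then show False using pos[of 0] by (simp add: eigenvector_def)
qed

text \<open>With the right inverse \<open>R\<close> of the shift, \<open>g = \<Sum>l. u ^ l * R ^ (l + 1) f\<close> solves the equation.
  Each coefficient of \<open>g\<close> is a finite sum, so convergence is only a question of norms: the
  norms of the powers of \<open>R\<close> grow polynomially, so after Cauchy-Schwarz the squared coefficients
  of \<open>g\<close> are dominated by the convolution of two summable sequences.\<close>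

lemma shift_minus_surjective:
  assumes u: "cmod u < 1" and f: "f \<in> hcar (H2 w)"
  obtains g where "g \<in> hcar (H2 w)" "shifted_op (H2 w) (backward_shift w) u g = f"
proof -
  define h where "h j = (\<Sum>i<j. u ^ (j - Suc i) * (complex_of_real (w i) * fps_nth f i))" for j
  define g where "g = Abs_fps (\<lambda>j. h j / complex_of_real (w j))"
  have h_Suc: "h (Suc j) = u * h j + complex_of_real (w j) * fps_nth f j" for j
    by (simp add: h_def sum_distrib_left Suc_diff_Suc flip: mult.assoc power_Suc)
  define a where "a i = (cmod (fps_nth f i))\<^sup>2 * w i" for i
  define b where "b l = cmod u ^ l * (K * (real l + 2) ^ d)" for l
  have a: "summable a" using f by (simp add: H2_def a_def[abs_def])
  have b: "summable b"
  proof (rule summable_comparison_test'[of _ 0])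
    show "summable (\<lambda>l. K * 2 ^ d * ((real l + 1) ^ d * cmod u ^ l))"
      using u by (intro summable_mult summable_polynomial_times_power) simp
    fix l
    have "(real l + 2) ^ d \<le> 2 ^ d * (real l + 1) ^ d"
      unfolding power_mult_distrib[symmetric] by (intro power_mono) auto
    then have "cmod u ^ l * K * (real l + 2) ^ d \<le> cmod u ^ l * K * (2 ^ d * (real l + 1) ^ d)"
      using K_pos by (intro mult_left_mono) auto
    then show "norm (b l) \<le> K * 2 ^ d * ((real l + 1) ^ d * cmod u ^ l)"
      using K_pos by (simp add: b_def mult_ac)
  qed
  have nonneg: "\<bar>a i\<bar> = a i" "\<bar>b i\<bar> = b i" for i
    using K_pos pos[of i] by (simp_all add: a_def b_def)
  have conv: "summable (\<lambda>j. 1 / (1 - cmod u) * (\<Sum>i\<le>j. a i * b (j - i)))"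
    using a b by (intro summable_mult summable_Cauchy_product) (simp_all add: nonneg)
  have bound: "(cmod (fps_nth g (Suc j)))\<^sup>2 * w (Suc j) \<le> 1 / (1 - cmod u) * (\<Sum>i\<le>j. a i * b (j - i))" for j
  proof -
    (* Half of the geometric weight goes into each factor of the Cauchy-Schwarz inequality. *)
    define p where "p i = sqrt (cmod u ^ (j - i))" for i
    define y where "y i = w i * cmod (fps_nth f i)" for i
    have p2: "(p i)\<^sup>2 = cmod u ^ (j - i)" for i by (simp add: p_def)
    have "cmod (h (Suc j)) \<le> (\<Sum>i\<le>j. p i * (p i * y i))"
      unfolding h_def lessThan_Suc_atMost
      by (rule order_trans[OF norm_sum], rule sum_mono)
         (use pos in \<open>simp add: norm_mult norm_power y_def less_imp_le flip: p2 power2_eq_square mult.assoc\<close>)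
    then have "(cmod (h (Suc j)))\<^sup>2 \<le> (\<Sum>i\<le>j. p i * (p i * y i))\<^sup>2"
      by (rule power_mono) simp
    also have "\<dots> \<le> (\<Sum>i\<le>j. (p i)\<^sup>2) * (\<Sum>i\<le>j. (p i * y i)\<^sup>2)"
      by (rule Cauchy_Schwarz_ineq_sum)
    also have "\<dots> \<le> 1 / (1 - cmod u) * (\<Sum>i\<le>j. (p i * y i)\<^sup>2)"
    proof (rule mult_right_mono)
      have "(\<Sum>i\<le>j. (p i)\<^sup>2) = (\<Sum>i\<le>j. cmod u ^ i)"
        unfolding p2 by (rule sum.reindex_bij_witness[of _ "\<lambda>i. j - i" "\<lambda>i. j - i"]) auto
      also have "\<dots> \<le> (\<Sum>i. cmod u ^ i)"
        using u by (intro sum_le_suminf summable_geometric) auto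
      finally show "(\<Sum>i\<le>j. (p i)\<^sup>2) \<le> 1 / (1 - cmod u)" using u by (simp add: suminf_geometric)
    qed (simp add: sum_nonneg)
    finally have "(cmod (h (Suc j)))\<^sup>2 / w (Suc j) \<le> 1 / (1 - cmod u) * (\<Sum>i\<le>j. (p i * y i)\<^sup>2) / w (Suc j)"
      using pos[of "Suc j"] by (intro divide_right_mono) auto
    also have "\<dots> = 1 / (1 - cmod u) * (\<Sum>i\<le>j. (p i * y i)\<^sup>2 / w (Suc j))"
      by (simp add: sum_divide_distrib mult.commute)
    also have "\<dots> \<le> 1 / (1 - cmod u) * (\<Sum>i\<le>j. a i * b (j - i))"
    proof (intro mult_left_mono sum_mono)
      fix i assume i: "i \<in> {..j}"
      have "w i \<le> K * (real (j - i) + 2) ^ d * w (Suc j)"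
        using decay[of i "Suc j - i"] i by (simp add: of_nat_diff Suc_diff_le algebra_simps)
      then have le: "w i / w (Suc j) \<le> K * (real (j - i) + 2) ^ d"
        using pos[of "Suc j"] by (simp add: divide_le_eq)
      have "(p i * y i)\<^sup>2 / w (Suc j) = a i * cmod u ^ (j - i) * (w i / w (Suc j))"
        unfolding power_mult_distrib p2 by (simp add: y_def a_def power2_eq_square)
      also have "\<dots> \<le> a i * cmod u ^ (j - i) * (K * (real (j - i) + 2) ^ d)"
        by (rule mult_left_mono[OF le]) (simp add: a_def pos less_imp_le)
      finally show "(p i * y i)\<^sup>2 / w (Suc j) \<le> a i * b (j - i)" by (simp add: b_def mult.assoc)
    qed (use u in simp)
    finally show ?thesis
      using pos[of "Suc j"] by (simp add: g_def norm_divide power_divide power2_eq_square)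
  qed
  have "summable (\<lambda>j. (cmod (fps_nth g (Suc j)))\<^sup>2 * w (Suc j))"
    by (rule summable_comparison_test'[OF conv, of 0]) (use bound pos in \<open>auto simp: less_imp_le\<close>)
  then have g: "g \<in> hcar (H2 w)"
    by (simp add: H2_def summable_Suc_iff[of "\<lambda>j. (cmod (fps_nth g j))\<^sup>2 * w j"])
  moreover have "shifted_op (H2 w) (backward_shift w) u g = f"
  proof (rule fps_ext)
    fix j
    have g_nth: "fps_nth g j = h j / complex_of_real (w j)" for j by (simp add: g_def)
    show "fps_nth (shifted_op (H2 w) (backward_shift w) u g) j = fps_nth f j"
      using pos[of j] pos[of "Suc j"]
      by (simp add: shifted_op_def hscale_H2 shift_nth[OF g] g_nth h_Suc field_simps)
  qed
  ultimately show thesis by (rule that)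
qed

abbreviation eigenspan :: "complex fps set" where
  "eigenspan \<equiv> module.span (hscale (H2 w))
     (\<Union>u\<in>ball 0 1. op_kernel (H2 w) (shifted_op (H2 w) (backward_shift w) u))"

lemma eigenspan_subset: "eigenspan \<subseteq> hcar (H2 w)"
proof -
  interpret vector_space "\<lambda>c f. fps_const c * (f :: complex fps)" by (rule vector_space_fps)
  have "subspace (hcar (H2 w))"
    using hilbert_space_H2[of w] pos by (simp add: hilbert_space_def hscale_H2)
  then show ?thesis
    unfolding hscale_H2 by (intro span_minimal) (auto simp: op_kernel_def)
qed

text \<open>Averaging the eigenvectors at \<open>\<omega> ^ m / 2\<close> over the \<open>N\<close>-th roots of unity \<open>\<omega> ^ m\<close>, twisted by a
  character, leaves only the coefficients with index congruent to \<open>k\<close> modulo \<open>N\<close>. Below \<open>N\<close> this is the single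
  monomial of degree \<open>k\<close>, and the remaining tail is small for large \<open>N\<close> because the radius 1/2 is less
  than 1.\<close>

lemma monomial_near_eigenspan:
  assumes e: "e > 0"
  obtains g where "g \<in> eigenspan" "hnorm (H2 w) (fps_X ^ k - g) \<le> e"
proof -
  interpret vector_space "\<lambda>c f. fps_const c * (f :: complex fps)" by (rule vector_space_fps)
  have w0: "w j \<noteq> 0" for j using pos[of j] by simp
  (* The factor that normalizes the coefficient of degree k to 1. *)
  define c where "c = 2 ^ k * w k"
  have c: "c > 0" using pos by (simp add: c_def)
  have "summable (\<lambda>j. c\<^sup>2 * (1 / w j * (1 / 4) ^ j))"
    by (intro summable_mult summable_power_div_weight) simp
  from suminf_exist_split[OF _ this, of "e\<^sup>2"] e obtain N\<^sub>0 where
    N\<^sub>0: "\<And>N. N \<ge> N\<^sub>0 \<Longrightarrow> norm (\<Sum>i. c\<^sup>2 * (1 / w (i + N) * (1 / 4) ^ (i + N))) < e\<^sup>2" by auto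
  define N where "N = max N\<^sub>0 (Suc k)"
  have N: "N > k" "N > 0" by (auto simp: N_def)
  define \<omega> where "\<omega> = exp (2 * of_real pi * \<i> / of_nat N :: complex)"
  have norm\<omega>: "cmod \<omega> = 1"
    by (simp add: \<omega>_def norm_exp_eq_Re)
  define g where "g = (\<Sum>m<N. fps_const (complex_of_real (c / N) * \<omega> ^ (m * (N - k))) * eigenvector w (\<omega> ^ m / 2))"
  have "g \<in> eigenspan"
    unfolding g_def hscale_H2
  proof (intro span_sum span_scale span_base UN_I)
    fix m assume "m \<in> {..<N}"
    have "cmod (\<omega> ^ m / 2) < 1" by (simp add: norm_divide norm_power norm\<omega>)
    then show "\<omega> ^ m / 2 \<in> ball 0 1"
      "eigenvector w (\<omega> ^ m / 2) \<in> op_kernel (H2 w) (shifted_op (H2 w) (backward_shift w) (\<omega> ^ m / 2))"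
      using eigenvector_in_carrier(1) eigenvector_in_kernel by (auto simp: op_kernel_def)
  qed
  moreover have "hnorm (H2 w) (fps_X ^ k - g) \<le> e"
  proof -
    have g_nth: "fps_nth g j = complex_of_real (c / N / 2 ^ j / w j) * (\<Sum>m<N. \<omega> ^ (m * (N - k + j)))" for j
      by (simp add: g_def fps_sum_nth eigenvector_def sum_distrib_left power_add algebra_simps
            power_divide flip: power_mult)
    have sum\<omega>: "(\<Sum>m<N. \<omega> ^ (m * i)) = (if N dvd i then of_nat N else 0)" for i
      unfolding \<omega>_def by (rule root_of_unity_power_sum[OF N(2)])
    have low: "fps_nth g j = (if j = k then 1 else 0)" if j: "j < N" for j
    proof -
      have "N dvd N - k + j \<longleftrightarrow> j = k"
      proof
        assume "N dvd N - k + j"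
        then obtain q where q: "N - k + j = N * q" by (elim dvdE)
        then have "0 < N * q" "N * q < N * 2" using N j by linarith+
        then have "q = 1" by simp
        with q N show "j = k" by simp
      qed (use N in simp)
      moreover have "c / 2 ^ k / w k = 1" using w0[of k] by (simp add: c_def)
      ultimately show ?thesis
        using N by (simp add: g_nth sum\<omega> c_def w0)
    qed
    have high: "(cmod (fps_nth g j))\<^sup>2 * w j \<le> c\<^sup>2 * (1 / w j * (1 / 4) ^ j)" for j
    proof -
      have "cmod (fps_nth g j) \<le> c / N / 2 ^ j / w j * N"
        unfolding g_nth sum\<omega> using c pos[of j] by (simp add: norm_mult norm_divide norm_power less_imp_le)
      then have "(cmod (fps_nth g j))\<^sup>2 \<le> (c / 2 ^ j / w j)\<^sup>2"
        using N by (intro power_mono) auto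
      then have "(cmod (fps_nth g j))\<^sup>2 * w j \<le> (c / 2 ^ j / w j)\<^sup>2 * w j"
        using pos[of j] by (intro mult_right_mono) auto
      also have "\<dots> = c\<^sup>2 * (1 / w j * (1 / 4) ^ j)"
      proof -
        have "(2 ^ j)\<^sup>2 = (4 ^ j :: real)" by (simp add: power2_eq_square flip: power_mult_distrib)
        then show ?thesis using w0[of j] by (simp add: power_divide power2_eq_square field_simps)
      qed
      finally show ?thesis .
    qed
    have gH: "g \<in> hcar (H2 w)" using \<open>g \<in> eigenspan\<close> eigenspan_subset by blast
    have "hnorm (H2 w) (g - fps_X ^ k) \<le> e"
    proof (rule H2_approxI[OF pos gH])
      show "(\<Sum>j<N. (cmod (fps_nth (g - fps_X ^ k) j))\<^sup>2 * w j) \<le> 0"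
        by (intro sum_nonpos) (simp add: low fps_X_power_nth)
      have "(\<Sum>j. (cmod (fps_nth g (j + N)))\<^sup>2 * w (j + N))
          \<le> (\<Sum>j. c\<^sup>2 * (1 / w (j + N) * (1 / 4) ^ (j + N)))"
      proof (rule suminf_le[OF high])
        show "summable (\<lambda>j. (cmod (fps_nth g (j + N)))\<^sup>2 * w (j + N))"
          using gH by (subst summable_iff_shift) (simp add: H2_def)
        show "summable (\<lambda>j. c\<^sup>2 * (1 / w (j + N) * (1 / 4) ^ (j + N)))"
          by (subst summable_iff_shift) fact
      qed
      then show "(\<Sum>j. (cmod (fps_nth g (j + N)))\<^sup>2 * w (j + N)) \<le> e\<^sup>2"
        using N\<^sub>0[of N] by (auto simp: N_def)
    qed (use N e in \<open>auto simp: fps_X_power_nth\<close>)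
    then show ?thesis by (simp add: hnorm_H2_uminus)
  qed
  ultimately show thesis by (rule that)
qed

lemma eigenspan_dense:
  assumes f: "f \<in> hcar (H2 w)" and e: "e > 0"
  shows "\<exists>g\<in>eigenspan. hnorm (H2 w) (f - g) < e"
proof -
  interpret vector_space "\<lambda>c f. fps_const c * (f :: complex fps)" by (rule vector_space_fps)
  define near where "near f \<longleftrightarrow> f \<in> hcar (H2 w) \<and> (\<forall>e>0. \<exists>g\<in>eigenspan. hnorm (H2 w) (f - g) \<le> e)" for f
  have mono: "near (fps_const c * fps_X ^ k)" for c k
    unfolding near_def
  proof (intro conjI allI impI H2_scale H2_monom)
    fix e :: real assume "e > 0"
    then have "e / (cmod c + 1) > 0" by (simp add: add_nonneg_pos)
    then obtain g where g: "g \<in> eigenspan" "hnorm (H2 w) (fps_X ^ k - g) \<le> e / (cmod c + 1)"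
      by (rule monomial_near_eigenspan)
    have m: "fps_X ^ k - g \<in> hcar (H2 w)" using g(1) eigenspan_subset by (intro H2_minus[OF pos] H2_monom) auto
    have "hnorm (H2 w) (fps_const c * (fps_X ^ k - g)) \<le> (cmod c + 1) * (e / (cmod c + 1))"
      unfolding hnorm_H2_scale[OF pos m] using g(2) hnorm_H2_nonneg[OF pos m]
      by (intro mult_mono) auto
    also have "\<dots> = e" by (simp add: add_nonneg_eq_0_iff)
    finally have "hnorm (H2 w) (fps_const c * fps_X ^ k - fps_const c * g) \<le> e"
      by (simp add: algebra_simps)
    moreover have "fps_const c * g \<in> eigenspan" using g(1) unfolding hscale_H2 by (rule span_scale)
    ultimately show "\<exists>g\<in>eigenspan. hnorm (H2 w) (fps_const c * fps_X ^ k - g) \<le> e" by blast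
  qed
  have add: "near (f + g)" if "near f" "near g" for f g
    unfolding near_def
  proof (intro conjI allI impI)
    show "f + g \<in> hcar (H2 w)" using that by (intro H2_add[OF pos]) (auto simp: near_def)
    fix e :: real assume "e > 0"
    then have "e / 2 > 0" by simp
    have "\<exists>g\<in>eigenspan. hnorm (H2 w) (h - g) \<le> e / 2" if "near h" for h
      using that \<open>e / 2 > 0\<close> unfolding near_def by blast
    from this[OF that(1)] this[OF that(2)] obtain f' g' where *:
      "f' \<in> eigenspan" "hnorm (H2 w) (f - f') \<le> e / 2"
      "g' \<in> eigenspan" "hnorm (H2 w) (g - g') \<le> e / 2" by blast
    have "f - f' \<in> hcar (H2 w)" "g - g' \<in> hcar (H2 w)"
      using that * eigenspan_subset by (auto intro!: H2_minus[OF pos] simp: near_def)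
    from H2_triangle[OF pos this] * have "hnorm (H2 w) ((f + g) - (f' + g')) \<le> e"
      by (simp add: algebra_simps)
    moreover have "f' + g' \<in> eigenspan" using * unfolding hscale_H2 by (intro span_add)
    ultimately show "\<exists>h\<in>eigenspan. hnorm (H2 w) (f + g - h) \<le> e" by blast
  qed
  have poly: "near (\<Sum>j<N. fps_const (fps_nth f j) * fps_X ^ j)" for N
  proof (induction N)
    case 0
    show ?case using mono[of 0 0] by simp
  qed (simp add: add mono)
  have "(e / 2)\<^sup>2 > 0" using e by simp
  then obtain N where N: "(\<Sum>j. (cmod (fps_nth f (j + N)))\<^sup>2 * w (j + N)) \<le> (e / 2)\<^sup>2"
    using H2_tail[OF f] by blast
  define p where "p = (\<Sum>j<N. fps_const (fps_nth f j) * fps_X ^ j)"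
  have p_nth: "fps_nth p j = (if j < N then fps_nth f j else 0)" for j
    by (simp add: p_def fps_sum_nth fps_X_power_nth if_distrib[of "\<lambda>x. _ * x"] cong: if_cong)
  have 1: "hnorm (H2 w) (f - p) \<le> e / 2"
    by (rule H2_approxI[OF pos f _ _ N, of _ 0]) (use e in \<open>auto simp: p_nth\<close>)
  have "near p" unfolding p_def by (rule poly)
  moreover have "e / 4 > 0" using e by simp
  ultimately obtain g where g: "g \<in> eigenspan" "hnorm (H2 w) (p - g) \<le> e / 4" and p: "p \<in> hcar (H2 w)"
    unfolding near_def by blast
  have "hnorm (H2 w) ((f - p) + (p - g)) \<le> e / 2 + e / 4"
    using g eigenspan_subset p f
    by (intro order_trans[OF H2_triangle[OF pos] add_mono[OF 1 g(2)]] H2_minus[OF pos]) auto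
  with g(1) e show ?thesis by (intro bexI[of _ g]) auto
qed

lemma cowen_douglas: "cowen_douglas_B1 (H2 w) (backward_shift w)"
  unfolding cowen_douglas_B1_def
proof (intro conjI ballI subsetI)
  interpret Metric_space "hcar (H2 w)" "hdist (H2 w)" by (rule Metric_space_H2[OF pos])
  interpret vector_space "\<lambda>c f. fps_const c * (f :: complex fps)" by (rule vector_space_fps)
  show "hilbert_space (H2 w)" by (rule hilbert_space_H2[OF pos])
  show "separable_space (htopology (H2 w))" by (rule separable_space_H2[OF pos])
  show "bounded_op (H2 w) (H2 w) (backward_shift w)" by (rule bounded_op_shift)
  show "htopology (H2 w) closure_of eigenspan = hcar (H2 w)"
    using eigenspan_dense eigenspan_subset
    by (auto simp: htopology_def metric_closure_of hdist_def subset_iff in_mball)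
  fix z :: complex assume "z \<in> ball 0 1"
  then have z: "cmod z < 1" by simp
  let ?T = "shifted_op (H2 w) (backward_shift w) z"
  note ev = eigenvector_in_carrier(1)[OF z] eigenvector_in_kernel[OF z]
  show "z \<in> op_spectrum (H2 w) (backward_shift w)"
    unfolding op_spectrum_def
  proof (intro CollectI notI)
    assume "invertible_op (H2 w) (H2 w) ?T"
    then obtain Y where Y: "\<And>f. f \<in> hcar (H2 w) \<Longrightarrow> Y (?T f) = f"
      by (auto simp: invertible_op_def)
    have 0: "0 \<in> hcar (H2 w)" using H2_finite_support[of 0 0 w] by simp
    have "?T 0 = 0" by (subst kernel_iff[OF 0]) simp
    with Y[OF 0] Y[OF ev(1)] ev(2) have "eigenvector w z = 0" by simp
    with eigenvector_nonzero show False by blast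
  qed
  have "?T ` hcar (H2 w) = hcar (H2 w)"
  proof (intro equalityI subsetI)
    fix f assume "f \<in> ?T ` hcar (H2 w)"
    then show "f \<in> hcar (H2 w)"
      by (auto simp: shifted_op_def hscale_H2 intro!: H2_minus[OF pos] H2_scale shift_in_carrier)
  next
    fix f assume "f \<in> hcar (H2 w)"
    with z obtain g where "g \<in> hcar (H2 w)" "?T g = f" by (rule shift_minus_surjective)
    then show "f \<in> ?T ` hcar (H2 w)" by blast
  qed
  then show "closedin (htopology (H2 w)) (?T ` hcar (H2 w))"
    using closedin_topspace[of mtopology] by (simp add: htopology_def)
  have ker: "op_kernel (H2 w) ?T = span {eigenvector w z}"
  proof (intro equalityI subsetI)
    fix f assume "f \<in> op_kernel (H2 w) ?T"
    then show "f \<in> span {eigenvector w z}"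
      using kernel_iff[of f z] by (auto simp: op_kernel_def span_singleton)
  next
    fix f assume "f \<in> span {eigenvector w z}"
    then obtain c where c: "f = fps_const c * eigenvector w z" by (auto simp: span_singleton)
    then have "f \<in> hcar (H2 w)" using H2_scale ev(1) by blast
    moreover from this have "?T f = 0"
      using pos[of 0] by (subst kernel_iff) (simp_all add: c eigenvector_def)
    ultimately show "f \<in> op_kernel (H2 w) ?T" by (simp add: op_kernel_def)
  qed
  have "dim (span {eigenvector w z}) = card {eigenvector w z}"
    using eigenvector_nonzero by (intro dim_span_eq_card_independent) (simp add: dependent_single)
  then show "vector_space.dim (hscale (H2 w)) (op_kernel (H2 w) ?T) = 1"
    by (simp add: ker hscale_H2)
qed

section \<open>Curvature of a backward shift\<close>

text \<open>The difference quotients converge coefficientwise; for the power \<open>u ^ j\<close> the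
  error is at most \<open>j * (j - 1) * r ^ (j - 2) * \<bar>u - z\<bar>\<close> on a disk of radius \<open>r < 1\<close>, and divided by the weights these
  errors have a norm of order \<open>\<bar>u - z\<bar>\<close>.\<close>

lemma kernel_section_eigenvector: "kernel_section (H2 w) (backward_shift w) (eigenvector w)"
  unfolding kernel_section_def hilbert_holomorphic_on_def op_kernel_def
proof (intro conjI ballI CollectI eigenvector_nonzero)
  fix z :: complex assume "z \<in> ball 0 1"
  then have z: "cmod z < 1" by simp
  show "eigenvector w z \<in> hcar (H2 w)" "eigenvector w z \<in> hcar (H2 w)"
    "shifted_op (H2 w) (backward_shift w) z (eigenvector w z) = 0"
    using eigenvector_in_carrier(1)[OF z] eigenvector_in_kernel[OF z] by auto
  define r where "r = (1 + cmod z) / 2"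
  have r: "cmod z < r" "0 < r" "r < 1" using z by (auto simp: r_def add_pos_nonneg)
  define D where "D = Abs_fps (\<lambda>j. of_nat j * z ^ (j - 1) / complex_of_real (w j))"
  define Q where "Q u = fps_const (1 / (u - z)) * (eigenvector w u - eigenvector w z) - D" for u
  define M where "M j = (real j * real (j - 1) * r ^ (j - 2))\<^sup>2 / w j" for j
  have "summable M"
  proof -
    have "summable (\<lambda>j. K / w 0 * (1 / r ^ 4) * ((real j + 1) ^ (d + 4) * (r\<^sup>2) ^ j))"
      using r by (intro summable_mult summable_polynomial_times_power) (simp add: power_less_one_iff)
    then show ?thesis
    proof (rule summable_comparison_test'[of _ 0])
      fix j :: nat
      have "real j * real (j - 1) * r ^ (j - 2) \<le> (real j + 1) * (real j + 1) * (r ^ j / r\<^sup>2)"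
      proof (cases "j \<ge> 2")
        case True
        then have "r ^ (j - 2) = r ^ j / r\<^sup>2" using r by (simp add: power_diff)
        then show ?thesis using r by (intro mult_mono) auto
      next
        case False
        then have "j = 0 \<or> j = 1" by auto
        then show ?thesis using r by auto
      qed
      then have "(real j * real (j - 1) * r ^ (j - 2))\<^sup>2 \<le> ((real j + 1) * (real j + 1) * (r ^ j / r\<^sup>2))\<^sup>2"
        using r by (intro power_mono) auto
      also have "\<dots> = (real j + 1) ^ 4 * ((r\<^sup>2) ^ j / r ^ 4)"
        by (simp add: power_mult_distrib power_divide mult.commute flip: power_mult power_add)
      finally have "M j \<le> (real j + 1) ^ 4 * ((r\<^sup>2) ^ j / r ^ 4) * (1 / w j)"
        using mult_right_mono[of _ _ "1 / w j"] pos[of j] by (fastforce simp: M_def)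
      also have "\<dots> \<le> (real j + 1) ^ 4 * ((r\<^sup>2) ^ j / r ^ 4) * (K / w 0 * (real j + 1) ^ d)"
        using inverse_le[of j] r by (intro mult_left_mono) auto
      also have "\<dots> = K / w 0 * (1 / r ^ 4) * ((real j + 1) ^ (d + 4) * (r\<^sup>2) ^ j)"
        by (simp add: power_add mult_ac)
      finally show "norm (M j) \<le> K / w 0 * (1 / r ^ 4) * ((real j + 1) ^ (d + 4) * (r\<^sup>2) ^ j)"
        using pos[of j] by (simp add: M_def)
    qed
  qed
  have M0: "M j \<ge> 0" for j using pos[of j] by (simp add: M_def)
  define B where "B = sqrt (suminf M)"
  have B: "B \<ge> 0" "B\<^sup>2 = suminf M" using suminf_nonneg[OF \<open>summable M\<close>] M0 by (auto simp: B_def)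
  have Q: "Q u \<in> hcar (H2 w) \<and> hnorm (H2 w) (Q u) \<le> B * cmod (u - z)"
    if u: "u \<noteq> z" "cmod (u - z) < r - cmod z" for u
  proof -
    have ur: "cmod u \<le> r" using norm_triangle_ineq[of z "u - z"] u(2) by simp
    have nth: "(cmod (fps_nth (Q u) j))\<^sup>2 * w j \<le> (cmod (u - z))\<^sup>2 * M j" for j
    proof -
      have "fps_nth (Q u) j = ((u ^ j - z ^ j) / (u - z) - of_nat j * z ^ (j - Suc 0)) / complex_of_real (w j)"
        by (simp add: Q_def eigenvector_def D_def diff_divide_distrib right_diff_distrib)
      moreover have "cmod ((u ^ j - z ^ j) / (u - z) - of_nat j * z ^ (j - Suc 0))
          \<le> real j * real (j - 1) * r ^ (j - 2) * cmod (u - z)"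
        using lemma_termdiff3[of "u - z" z r j] u(1) ur r(1) by simp
      ultimately have "cmod (fps_nth (Q u) j) \<le> real j * real (j - 1) * r ^ (j - 2) * cmod (u - z) / w j"
        using pos[of j] by (simp add: norm_divide divide_right_mono)
      then have "(cmod (fps_nth (Q u) j))\<^sup>2 * w j
          \<le> (real j * real (j - 1) * r ^ (j - 2) * cmod (u - z) / w j)\<^sup>2 * w j"
        using pos[of j] by (intro mult_right_mono power_mono) auto
      also have "\<dots> = (cmod (u - z))\<^sup>2 * M j"
        using pos[of j] by (simp add: M_def power_mult_distrib power_divide power2_eq_square)
      finally show ?thesis .
    qed
    have "(\<Sum>j<N. (cmod (fps_nth (Q u) j))\<^sup>2 * w j) \<le> (B * cmod (u - z))\<^sup>2" for N
    proof -
      have "(\<Sum>j<N. (cmod (fps_nth (Q u) j))\<^sup>2 * w j) \<le> (cmod (u - z))\<^sup>2 * (\<Sum>j<N. M j)"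
        unfolding sum_distrib_left by (rule sum_mono) (rule nth)
      also have "\<dots> \<le> (cmod (u - z))\<^sup>2 * suminf M"
        by (intro mult_left_mono sum_le_suminf) (use \<open>summable M\<close> M0 in auto)
      finally show ?thesis by (simp add: power_mult_distrib B(2) mult.commute)
    qed
    then show ?thesis using H2_normI[of w "B * cmod (u - z)" "Q u"] pos B(1) by simp
  qed
  have ev: "\<forall>\<^sub>F u in at z within ball 0 1. u \<noteq> z \<and> cmod (u - z) < r - cmod z"
    unfolding eventually_at by (intro exI[of _ "r - cmod z"]) (use r in \<open>auto simp: dist_norm\<close>)
  have "D \<in> hcar (H2 w)"
  proof -
    define u where "u = z + complex_of_real ((r - cmod z) / 2)"
    have u: "u \<noteq> z" "cmod (u - z) < r - cmod z" using r(1) by (auto simp: u_def norm_divide simp flip: of_real_diff)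
    have "cmod u < 1" using norm_triangle_ineq[of z "u - z"] u(2) r by simp
    then have "fps_const (1 / (u - z)) * (eigenvector w u - eigenvector w z) - Q u \<in> hcar (H2 w)"
      using Q[OF u] eigenvector_in_carrier(1) z by (intro H2_minus[OF pos] H2_scale) auto
    then show ?thesis by (simp add: Q_def)
  qed
  moreover have "((\<lambda>u. hnorm (H2 w) (Q u)) \<longlongrightarrow> 0) (at z within ball 0 1)"
  proof (rule tendsto_sandwich)
    show "\<forall>\<^sub>F u in at z within ball 0 1. 0 \<le> hnorm (H2 w) (Q u)"
      by (rule eventually_mono[OF ev]) (use Q hnorm_H2_nonneg[of w, OF pos] in auto)
    show "\<forall>\<^sub>F u in at z within ball 0 1. hnorm (H2 w) (Q u) \<le> B * cmod (u - z)"
      by (rule eventually_mono[OF ev]) (use Q in blast)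
    have "((\<lambda>u. B * cmod (u - z)) \<longlongrightarrow> B * cmod (z - z)) (at z within ball 0 1)"
      by (intro tendsto_intros)
    then show "((\<lambda>u. B * cmod (u - z)) \<longlongrightarrow> 0) (at z within ball 0 1)" by simp
  qed auto
  ultimately show "\<exists>d\<in>hcar (H2 w). ((\<lambda>u. hnorm (H2 w)
      (hscale (H2 w) (1 / (u - z)) (eigenvector w u - eigenvector w z) - d)) \<longlongrightarrow> 0) (at z within ball 0 1)"
    unfolding hscale_H2 Q_def by blast
qed

text \<open>Coefficient functionals are bounded, so they turn Hilbert space differentiability into
  complex differentiability.\<close>

lemma section_coefficient_holomorphic:
  assumes \<gamma>: "hilbert_holomorphic_on (H2 w) \<gamma> (ball 0 1)"
  shows "(\<lambda>u. fps_nth (\<gamma> u) k) holomorphic_on ball 0 1"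
  unfolding holomorphic_on_def
proof
  fix z :: complex assume z: "z \<in> ball 0 1"
  then obtain d where d: "d \<in> hcar (H2 w)" and lim: "((\<lambda>u. hnorm (H2 w)
      (fps_const (1 / (u - z)) * (\<gamma> u - \<gamma> z) - d)) \<longlongrightarrow> 0) (at z within ball 0 1)"
    using \<gamma> unfolding hilbert_holomorphic_on_def hscale_H2 by blast
  have \<gamma>H: "\<gamma> u \<in> hcar (H2 w)" if "u \<in> ball 0 1" for u
    using \<gamma> that by (auto simp: hilbert_holomorphic_on_def)
  have "((\<lambda>u. (fps_nth (\<gamma> u) k - fps_nth (\<gamma> z) k) / (u - z) - fps_nth d k) \<longlongrightarrow> 0) (at z within ball 0 1)"
  proof (rule Lim_null_comparison)
    show "((\<lambda>u. hnorm (H2 w) (fps_const (1 / (u - z)) * (\<gamma> u - \<gamma> z) - d) / sqrt (w k)) \<longlongrightarrow> 0)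
        (at z within ball 0 1)"
      using tendsto_divide[OF lim tendsto_const, of "sqrt (w k)"] pos[of k] by simp
    show "\<forall>\<^sub>F u in at z within ball 0 1. norm ((fps_nth (\<gamma> u) k - fps_nth (\<gamma> z) k) / (u - z) - fps_nth d k)
        \<le> hnorm (H2 w) (fps_const (1 / (u - z)) * (\<gamma> u - \<gamma> z) - d) / sqrt (w k)"
      unfolding eventually_at_filter
    proof (intro always_eventually allI impI)
      fix u :: complex assume "u \<in> ball 0 1"
      then have "fps_const (1 / (u - z)) * (\<gamma> u - \<gamma> z) - d \<in> hcar (H2 w)"
        using \<gamma>H z d by (intro H2_minus[OF pos] H2_scale) auto
      from H2_coeff_le[OF pos this, of k]
      show "norm ((fps_nth (\<gamma> u) k - fps_nth (\<gamma> z) k) / (u - z) - fps_nth d k)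
        \<le> hnorm (H2 w) (fps_const (1 / (u - z)) * (\<gamma> u - \<gamma> z) - d) / sqrt (w k)"
        using pos[of k] by (simp add: le_divide_eq)
    qed
  qed
  then have "((\<lambda>u. (fps_nth (\<gamma> u) k - fps_nth (\<gamma> z) k) / (u - z)) \<longlongrightarrow> fps_nth d k) (at z within ball 0 1)"
    by (rule LIM_zero_cancel)
  then show "(\<lambda>u. fps_nth (\<gamma> u) k) field_differentiable at z within ball 0 1"
    unfolding field_differentiable_def has_field_derivative_iff by blast
qed

text \<open>The curvature is defined with an unspecified section, so an arbitrary one is compared with
  the eigenvectors: it is \<open>exp (g u)\<close> times the eigenvector at \<open>u\<close> for some holomorphic \<open>g\<close>, because the disk is contractible,
  and then the logarithms of the squared norms differ by the harmonic function \<open>2 * Re (g u)\<close>.\<close>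

lemma curvature_eq:
  assumes z: "z \<in> ball 0 1"
    and \<phi>': "\<And>x. 0 \<le> x \<Longrightarrow> x < 1 \<Longrightarrow> ((\<lambda>x. ln (\<Sum>j. 1 / w j * x ^ j)) has_real_derivative \<phi>' x) (at x)"
    and \<phi>'': "\<And>x. 0 \<le> x \<Longrightarrow> x < 1 \<Longrightarrow> (\<phi>' has_real_derivative \<phi>'' x) (at x)"
  shows "curvature (H2 w) (backward_shift w) z =
           - complex_of_real (\<phi>' ((cmod z)\<^sup>2) + (cmod z)\<^sup>2 * \<phi>'' ((cmod z)\<^sup>2))"
proof -
  define \<gamma> where "\<gamma> = (SOME \<gamma>. kernel_section (H2 w) (backward_shift w) \<gamma>)"
  have sec: "kernel_section (H2 w) (backward_shift w) \<gamma>"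
    unfolding \<gamma>_def by (rule someI[of "kernel_section _ _", OF kernel_section_eigenvector])
  define c where "c u = complex_of_real (w 0) * fps_nth (\<gamma> u) 0" for u
  have \<gamma>: "\<gamma> u = fps_const (c u) * eigenvector w u" "\<gamma> u \<noteq> 0" if "u \<in> ball 0 1" for u
    using sec that kernel_iff[of "\<gamma> u" u] by (auto simp: kernel_section_def op_kernel_def c_def)
  have "c holomorphic_on ball 0 1"
    unfolding c_def using sec
    by (intro holomorphic_intros section_coefficient_holomorphic) (simp add: kernel_section_def)
  moreover have c0: "c u \<noteq> 0" if "u \<in> ball 0 1" for u
    using \<gamma>[OF that] by auto
  ultimately obtain g where g: "g holomorphic_on ball 0 1" "\<And>u. u \<in> ball 0 1 \<Longrightarrow> c u = exp (g u)"
    using contractible_imp_holomorphic_log[of c "ball 0 1"] convex_imp_contractible[OF convex_ball] by blast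
  have "ddbar (\<lambda>u. ln ((hnorm (H2 w) (\<gamma> u))\<^sup>2)) z
      = complex_of_real (\<phi>' ((cmod z)\<^sup>2) + (cmod z)\<^sup>2 * \<phi>'' ((cmod z)\<^sup>2))"
  proof (rule ddbar_harmonic_plus_radial[OF g(1) _ \<phi>' \<phi>'' z])
    fix u :: complex assume u: "u \<in> ball 0 1"
    then have u1: "cmod u < 1" by simp
    note ev = eigenvector_in_carrier[OF u1]
    have "hnorm (H2 w) (eigenvector w u) \<noteq> 0"
    proof
      assume "hnorm (H2 w) (eigenvector w u) = 0"
      then show False
        using H2_coeff_le[OF pos ev(1), of 0] pos[of 0] by (simp add: eigenvector_def divide_le_0_iff norm_divide zero_less_divide_iff)
    qed
    then have "ln ((hnorm (H2 w) (\<gamma> u))\<^sup>2) = ln ((cmod (c u))\<^sup>2) + ln ((hnorm (H2 w) (eigenvector w u))\<^sup>2)"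
      using c0[OF u] by (simp add: \<gamma>(1)[OF u] hnorm_H2_scale[OF pos ev(1)] power_mult_distrib ln_mult)
    also have "ln ((cmod (c u))\<^sup>2) = 2 * Re (g u)"
      using c0[OF u] by (simp add: ln_realpow g(2)[OF u] norm_exp_eq_Re)
    finally show "ln ((hnorm (H2 w) (\<gamma> u))\<^sup>2) = 2 * Re (g u) + ln (\<Sum>j. 1 / w j * ((cmod u)\<^sup>2) ^ j)"
      by (simp add: ev(2))
  qed
  then show ?thesis by (simp add: curvature_def \<gamma>_def[symmetric] Let_def)
qed

end

section \<open>Hypercontractivity and similarity of backward shifts\<close>

lemma adjoint_backward_shift:
  assumes w: "admissible_weight w" and g: "g \<in> hcar (H2 w)" "forward_shift g \<in> hcar (H2 w)"
  shows "adjoint_op (H2 w) (backward_shift w) g = forward_shift g"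
  unfolding adjoint_op_def
proof (rule the_equality)
  have pos: "w j > 0" for j using w by (simp add: admissible_weight_def)
  have sym: "hinner (H2 w) b a = cnj (hinner (H2 w) a b)" if "a \<in> hcar (H2 w)" "b \<in> hcar (H2 w)" for a b
    using hilbert_space_H2[of w, OF pos] that unfolding hilbert_space_def by blast
  have adj: "hinner (H2 w) (backward_shift w f) g = hinner (H2 w) f (forward_shift g)"
    if f: "f \<in> hcar (H2 w)" for f
  proof -
    have Tf: "backward_shift w f \<in> hcar (H2 w)"
      using H2_inner_adjoint(1)[OF w f] by (simp add: backward_shift_eq[OF w f])
    have "hinner (H2 w) (forward_shift g) f = hinner (H2 w) g (backward_shift w f)"
      using H2_inner_adjoint(2)[OF w f g(1)] by (simp add: backward_shift_eq[OF w f])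
    then show ?thesis using sym[OF g(1) Tf] sym[OF g(2) f] by simp
  qed
  with g(2) show "forward_shift g \<in> hcar (H2 w) \<and>
      (\<forall>f\<in>hcar (H2 w). hinner (H2 w) (backward_shift w f) g = hinner (H2 w) f (forward_shift g))" by blast
  fix h assume h: "h \<in> hcar (H2 w) \<and>
      (\<forall>f\<in>hcar (H2 w). hinner (H2 w) (backward_shift w f) g = hinner (H2 w) f h)"
  show "h = forward_shift g"
  proof (rule fps_ext)
    fix k
    have "hinner (H2 w) (fps_X ^ k) h = hinner (H2 w) (fps_X ^ k) (forward_shift g)"
      using h adj H2_monom by metis
    then show "fps_nth h k = fps_nth (forward_shift g) k"
      using pos[of k] by (simp add: H2_inner_monom)
  qed
qed

text \<open>The first-order inequality already fails at the vector \<open>z\<close>, whose squared norm \<open>w 1\<close>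
  is less than that of its image, \<open>(w 1)\<^sup>2 / w 0\<close>.\<close>

lemma not_hypercontraction:
  assumes w: "admissible_weight w" and n: "n \<ge> 1" and less: "w 0 < w 1"
  shows "\<not> n_hypercontraction n (H2 w) (backward_shift w)"
proof
  assume "n_hypercontraction n (H2 w) (backward_shift w)"
  then have *: "hinner (H2 w) (\<Sum>j\<le>1. hscale (H2 w) ((-1) ^ j * of_nat (1 choose j))
      ((adjoint_op (H2 w) (backward_shift w) ^^ j) ((backward_shift w ^^ j) fps_X))) fps_X \<in> \<real>\<^sub>\<ge>\<^sub>0"
    using n H2_monom[of 1 w] unfolding n_hypercontraction_def by fastforce
  have pos: "w j > 0" for j using w by (simp add: admissible_weight_def)
  have X: "fps_X \<in> hcar (H2 w)" using H2_monom[of 1 w] by simp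
  have TX: "backward_shift w fps_X = fps_const (complex_of_real (w 1 / w 0))"
    by (simp add: backward_shift_eq[OF w X] fps_eq_iff)
  have "adjoint_op (H2 w) (backward_shift w) (backward_shift w fps_X)
      = fps_X * fps_const (complex_of_real (w 1 / w 0))"
    unfolding TX
    by (subst adjoint_backward_shift[OF w])
       (auto simp: forward_shift_def intro: H2_finite_support[of 1] H2_finite_support[of 2])
  then have "(\<Sum>j\<le>1. hscale (H2 w) ((-1) ^ j * of_nat (1 choose j))
      ((adjoint_op (H2 w) (backward_shift w) ^^ j) ((backward_shift w ^^ j) fps_X)))
      = fps_X + fps_const (- 1) * (fps_X * fps_const (complex_of_real (w 1 / w 0)))"
    by (simp add: hscale_H2)
  also have "\<dots> = fps_const (1 - complex_of_real (w 1 / w 0)) * fps_X"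
    by (simp add: fps_eq_iff)
  finally have "(\<Sum>j\<le>1. hscale (H2 w) ((-1) ^ j * of_nat (1 choose j))
      ((adjoint_op (H2 w) (backward_shift w) ^^ j) ((backward_shift w ^^ j) fps_X)))
      = fps_const (1 - complex_of_real (w 1 / w 0)) * fps_X" .
  moreover have "hinner (H2 w) (fps_const c * fps_X) fps_X = c * complex_of_real (w 1)" for c
  proof -
    have "hinner (H2 w) (hscale (H2 w) c fps_X) fps_X = c * hinner (H2 w) fps_X fps_X"
      using hilbert_space_H2[of w, OF pos] X unfolding hilbert_space_def by blast
    then show ?thesis using H2_inner_monom[of w 1 fps_X] by (simp add: hscale_H2)
  qed
  ultimately have "(1 - complex_of_real (w 1 / w 0)) * complex_of_real (w 1) \<in> \<real>\<^sub>\<ge>\<^sub>0"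
    using * by simp
  then have "complex_of_real ((1 - w 1 / w 0) * w 1) \<in> \<real>\<^sub>\<ge>\<^sub>0" by simp
  then have "(1 - w 1 / w 0) * w 1 \<ge> 0" by (simp only: nonneg_Reals_of_real_iff)
  then show False
    using less pos[of 0] pos[of 1] by (simp add: zero_le_mult_iff)
qed

lemma backward_shift_power:
  assumes w: "admissible_weight w" and f: "f \<in> hcar (H2 w)"
  shows "(backward_shift w ^^ k) f \<in> hcar (H2 w)"
    and "fps_nth ((backward_shift w ^^ k) f) j = complex_of_real (w (j + k) / w j) * fps_nth f (j + k)"
proof -
  have nz: "w j \<noteq> 0" for j using w by (simp add: admissible_weight_def less_imp_neq[symmetric])
  have "(backward_shift w ^^ k) f \<in> hcar (H2 w) \<and>
      (\<forall>j. fps_nth ((backward_shift w ^^ k) f) j = complex_of_real (w (j + k) / w j) * fps_nth f (j + k))"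
  proof (induction k)
    case (Suc k)
    then show ?case
      using H2_inner_adjoint(1)[OF w, of "(backward_shift w ^^ k) f"] nz
      by (simp add: backward_shift_eq[OF w])
  qed (use f nz in simp)
  then show "(backward_shift w ^^ k) f \<in> hcar (H2 w)"
    "fps_nth ((backward_shift w ^^ k) f) j = complex_of_real (w (j + k) / w j) * fps_nth f (j + k)" by auto
qed

lemma hnorm_monomial:
  assumes "\<And>j. w j > 0"
  shows "hnorm (H2 w) (fps_X ^ k) = sqrt (w k)"
  by (simp add: hnorm_def H2_inner_monom)

text \<open>Let \<open>Y\<close> intertwine in the reverse direction. Applying the \<open>k\<close>-th powers of the shifts to
  \<open>z ^ k\<close> determines the coefficient of degree \<open>k\<close> of \<open>Y (z ^ k)\<close> up to the fixed nonzero
  factor \<open>Y 1\<close>, as the quotient of the weights; boundedness of \<open>Y\<close> then bounds that quotient.\<close>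

lemma similar_shifts_weight_ratio_bounded:
  assumes w: "admissible_weight w" and v: "admissible_weight v"
    and sim: "similar_ops (H2 w) (backward_shift w) (H2 v) (backward_shift v)"
  obtains B where "\<And>k. v k / w k \<le> B"
proof -
  have wp: "w j > 0" and vp: "v j > 0" for j using w v by (auto simp: admissible_weight_def)
  from sim obtain X Y where
    XT: "\<And>f. f \<in> hcar (H2 w) \<Longrightarrow> X (backward_shift w f) = backward_shift v (X f)"
    and Y: "bounded_op (H2 v) (H2 w) Y"
    and YX: "\<And>f. f \<in> hcar (H2 w) \<Longrightarrow> Y (X f) = f"
    and XY: "\<And>g. g \<in> hcar (H2 v) \<Longrightarrow> X (Y g) = g"
    unfolding similar_ops_def invertible_op_def by blast
  have Yc: "Y g \<in> hcar (H2 w)" if "g \<in> hcar (H2 v)" for g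
    using Y that by (simp add: bounded_op_def)
  have Ys: "Y (fps_const c * g) = fps_const c * Y g" if "g \<in> hcar (H2 v)" for c g
    using Y that by (simp add: bounded_op_def hscale_H2)
  obtain C where C: "\<And>g. g \<in> hcar (H2 v) \<Longrightarrow> hnorm (H2 w) (Y g) \<le> C * hnorm (H2 v) g"
    using Y unfolding bounded_op_def by blast
  have YT: "Y (backward_shift v g) = backward_shift w (Y g)" if g: "g \<in> hcar (H2 v)" for g
    using XT[OF Yc[OF g]] XY[OF g] YX[OF backward_shift_power(1)[OF w Yc[OF g], of 1]] by simp
  have YTk: "Y ((backward_shift v ^^ k) g) = (backward_shift w ^^ k) (Y g)" if g: "g \<in> hcar (H2 v)" for g k
    by (induction k) (simp_all add: YT backward_shift_power(1)[OF v g])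
  have one: "1 \<in> hcar (H2 v)" using H2_monom[of 0 v] by simp
  define y where "y = cmod (fps_nth (Y 1) 0)"
  have "y > 0"
  proof (rule ccontr)
    assume "\<not> y > 0"
    then have y0: "fps_nth (Y 1) 0 = 0" by (simp add: y_def)
    have zero: "(0 :: complex fps) \<in> hcar (H2 v)" by (rule H2_finite_support[of 0]) simp
    have Y0: "Y 0 = 0" using Ys[OF zero, of 0] by simp
    have "backward_shift v 1 = 0" by (simp add: backward_shift_eq[OF v one] fps_eq_iff)
    then have "backward_shift w (Y 1) = 0" using YT[OF one] Y0 by simp
    then have T0: "complex_of_real (w (Suc j) / w j) * fps_nth (Y 1) (Suc j) = 0" for j
      by (simp add: backward_shift_eq[OF w Yc[OF one]] fps_eq_iff)
    have "fps_nth (Y 1) (Suc j) = 0" for j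
      using T0[of j] wp[of j] wp[of "Suc j"] by simp
    with y0 have "Y 1 = 0" by (simp add: fps_eq_iff) (metis not0_implies_Suc)
    then have "(1 :: complex fps) = 0" using XY[OF one] XY[OF zero] Y0 by simp
    then show False by simp
  qed
  show thesis
  proof (rule that)
    fix k
    have m: "fps_X ^ k \<in> hcar (H2 v)" by (rule H2_monom)
    have "(backward_shift v ^^ k) (fps_X ^ k) = fps_const (complex_of_real (v k / v 0)) * 1"
      by (simp add: fps_eq_iff backward_shift_power(2)[OF v m] fps_X_power_nth)
    then have "(backward_shift w ^^ k) (Y (fps_X ^ k)) = fps_const (complex_of_real (v k / v 0)) * Y 1"
      using YTk[OF m, of k] Ys[OF one] by simp
    then have "fps_nth ((backward_shift w ^^ k) (Y (fps_X ^ k))) 0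
        = complex_of_real (v k / v 0) * fps_nth (Y 1) 0" by simp
    then have "complex_of_real (w k / w 0) * fps_nth (Y (fps_X ^ k)) k
        = complex_of_real (v k / v 0) * fps_nth (Y 1) 0"
      by (simp add: backward_shift_power(2)[OF w Yc[OF m]])
    then have "cmod (complex_of_real (w k / w 0) * fps_nth (Y (fps_X ^ k)) k)
        = cmod (complex_of_real (v k / v 0) * fps_nth (Y 1) 0)" by simp
    then have eq: "w k / w 0 * cmod (fps_nth (Y (fps_X ^ k)) k) = v k / v 0 * y"
      using wp[of k] wp[of 0] vp[of k] vp[of 0] by (simp add: norm_mult norm_divide y_def)
    have le: "cmod (fps_nth (Y (fps_X ^ k)) k) * sqrt (w k) \<le> C * sqrt (v k)"
      using H2_coeff_le[OF wp Yc[OF m], of k] C[OF m] by (simp add: hnorm_monomial[of v, OF vp])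
    have "v k / v 0 * y * sqrt (w k) = w k / w 0 * (cmod (fps_nth (Y (fps_X ^ k)) k) * sqrt (w k))"
      by (simp only: eq[symmetric] mult.assoc)
    also have "\<dots> \<le> w k / w 0 * (C * sqrt (v k))"
      using le wp[of k] wp[of 0] by (intro mult_left_mono) auto
    finally have *: "v k / v 0 * y * sqrt (w k) \<le> w k / w 0 * (C * sqrt (v k))" .
    define s t where "s = sqrt (v k)" and "t = sqrt (w k)"
    have st: "s > 0" "t > 0" "v k = s * s" "w k = t * t" using vp[of k] wp[of k] by (auto simp: s_def t_def)
    have "s * t * (s * w 0 * y) \<le> s * t * (t * v 0 * C)"
      using * st vp[of 0] wp[of 0] unfolding s_def[symmetric] t_def[symmetric] by (simp add: field_simps)
    then have "s * w 0 * y \<le> t * v 0 * C" using st by (simp add: mult_le_cancel_left_pos)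
    then have "s / t \<le> v 0 * C / (w 0 * y)" using st wp[of 0] \<open>y > 0\<close> by (simp add: field_simps)
    then have "(s / t)\<^sup>2 \<le> (v 0 * C / (w 0 * y))\<^sup>2" using st by (intro power_mono) auto
    then show "v k / w k \<le> (v 0 * C / (w 0 * y))\<^sup>2"
      using st by (simp add: power2_eq_square)
  qed
qed

section \<open>The coefficients of the kernel of the standard weighted space\<close>

definition kernel_coeff :: "nat \<Rightarrow> nat \<Rightarrow> real" where
  "kernel_coeff n j = real ((n + j - 1) choose j)"

lemma M_weight_eq: "M_weight n = (\<lambda>j. 1 / kernel_coeff n j)"
  by (simp add: M_weight_def kernel_coeff_def fun_eq_iff divide_inverse)

lemma kernel_coeff_0 [simp]: "kernel_coeff n 0 = 1"
  by (simp add: kernel_coeff_def)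

context
  fixes n :: nat
  assumes n: "n \<ge> 1"
begin

lemma kernel_coeff_Suc: "(real j + 1) * kernel_coeff n (Suc j) = (real n + real j) * kernel_coeff n j"
proof -
  have eq: "Suc (n + j - 1) = n + j" using n by simp
  have "(n + j) * ((n + j - 1) choose j) = ((n + j) choose Suc j) * Suc j"
    using Suc_times_binomial_eq[of "n + j - 1" j] unfolding eq .
  then have "real ((n + j) * ((n + j - 1) choose j)) = real (((n + j) choose Suc j) * Suc j)" by simp
  then show ?thesis by (simp add: kernel_coeff_def algebra_simps)
qed

lemma kernel_coeff_pos: "kernel_coeff n j > 0"
  using n by (simp add: kernel_coeff_def zero_less_binomial_iff)

lemma kernel_coeff_le_Suc: "kernel_coeff n j \<le> kernel_coeff n (Suc j)"
proof -
  have "(real j + 1) * kernel_coeff n j \<le> (real n + real j) * kernel_coeff n j"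
    using n kernel_coeff_pos[of j] by (intro mult_right_mono) auto
  then have "(real j + 1) * kernel_coeff n j \<le> (real j + 1) * kernel_coeff n (Suc j)" by (simp only: kernel_coeff_Suc)
  then show ?thesis by simp
qed

lemma kernel_coeff_mono: "i \<le> j \<Longrightarrow> kernel_coeff n i \<le> kernel_coeff n j"
  by (rule lift_Suc_mono_le[of "kernel_coeff n"]) (rule kernel_coeff_le_Suc)

lemma kernel_coeff_ge_1: "kernel_coeff n j \<ge> 1"
  using kernel_coeff_mono[of 0 j] by simp

text \<open>Consecutive quotients are \<open>1 + (n - 1) / (j + 1)\<close>, decreasing in the position \<open>j\<close>,
  so growth is fastest at the start, where it is polynomial.\<close>

lemma kernel_coeff_growth: "kernel_coeff n (j + l) \<le> (real l + 1) ^ n * kernel_coeff n j"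
proof (induction l)
  case (Suc l)
  have "1 + real n / (real l + 1) \<le> (1 + 1 / (real l + 1)) ^ n"
    using Bernoulli_inequality[of "1 / (real l + 1)" n] by (simp add: divide_simps)
  moreover have "(real n + real (j + l)) / (real (j + l) + 1) \<le> 1 + real n / (real l + 1)"
  proof -
    have "(real n + real (j + l)) / (real (j + l) + 1) \<le> 1 + real n / (real (j + l) + 1)"
      by (simp add: field_simps)
    also have "real n / (real (j + l) + 1) \<le> real n / (real l + 1)"
      by (intro divide_left_mono) auto
    finally show ?thesis by simp
  qed
  ultimately have *: "(real n + real (j + l)) / (real (j + l) + 1) \<le> (1 + 1 / (real l + 1)) ^ n" by linarith
  have "kernel_coeff n (j + Suc l) = (real n + real (j + l)) / (real (j + l) + 1) * kernel_coeff n (j + l)"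
    using kernel_coeff_Suc[of "j + l"] by (simp add: field_simps)
  also have "\<dots> \<le> (1 + 1 / (real l + 1)) ^ n * ((real l + 1) ^ n * kernel_coeff n j)"
    using Suc.IH kernel_coeff_pos[of "j + l"] * by (intro mult_mono) auto
  also have "\<dots> = ((1 + 1 / (real l + 1)) * (real l + 1)) ^ n * kernel_coeff n j"
    by (simp only: power_mult_distrib mult.assoc)
  also have "(1 + 1 / (real l + 1)) * (real l + 1) = real (Suc l) + 1"
    by (simp add: field_simps)
  finally show ?case .
qed simp

text \<open>The last coefficient is at most \<open>n\<close> times the average of all, since the coefficients grow
  like a power of exponent \<open>n - 1\<close>.\<close>

lemma kernel_coeff_last_le_sum: "real N * kernel_coeff n (N - 1) \<le> real n * (\<Sum>i<N. kernel_coeff n i)"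
proof (induction N)
  case (Suc N)
  show ?case
  proof (cases N)
    case 0
    with n show ?thesis by simp
  next
    case (Suc k)
    have "(real k + 2) * kernel_coeff n (Suc k) = (real n + real k) * kernel_coeff n k + kernel_coeff n (Suc k)"
      unfolding kernel_coeff_Suc[symmetric] by (simp add: algebra_simps)
    also have "\<dots> = (real k + 1) * kernel_coeff n k + ((real n - 1) * kernel_coeff n k + kernel_coeff n (Suc k))"
      by (simp add: algebra_simps)
    also have "(real n - 1) * kernel_coeff n k \<le> (real n - 1) * kernel_coeff n (Suc k)"
      using n kernel_coeff_le_Suc[of k] by (intro mult_left_mono) auto
    finally show ?thesis using Suc.IH Suc by (simp add: algebra_simps)
  qed
qed simp

lemma tame_weight_M: "tame_weight (M_weight n) 1 1 1 n"
proof
  fix j l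
  show "M_weight n j > 0" using kernel_coeff_pos by (simp add: M_weight_eq)
  show "M_weight n (Suc j) \<le> 1 * M_weight n j"
    using kernel_coeff_le_Suc[of j] kernel_coeff_pos[of j] by (simp add: M_weight_eq frac_le)
  show "M_weight n j \<le> 1" using kernel_coeff_ge_1[of j] by (simp add: M_weight_eq divide_le_eq)
  show "M_weight n j \<le> 1 * (real l + 1) ^ n * M_weight n (j + l)"
    using kernel_coeff_growth[of j l] kernel_coeff_pos[of j] kernel_coeff_pos[of "j + l"]
    by (simp add: M_weight_eq field_simps)
qed

end

section \<open>Slowly growing bumps\<close>

text \<open>A tent of height \<open>2 ^ k\<close>, slope \<open>1 / 2 ^ k\<close> and half-width \<open>4 ^ k\<close>. Heights tend to infinity,
  the slopes are summable, and the area \<open>8 ^ k\<close> is \<open>1 / 2 ^ k\<close> of the order of the position \<open>16 ^ k\<close>,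
  which makes the contributions to the averages summable as well.\<close>

definition bump :: "nat \<Rightarrow> nat \<Rightarrow> real" where
  "bump k j = max 0 (4 ^ k - \<bar>real j - 2 * 16 ^ k\<bar>) / 2 ^ k"

text \<open>Cutting the sum at \<open>j\<close> loses nothing, as all later bumps vanish at \<open>j\<close>
  (\<open>bump_factor_eq\<close>).\<close>

definition bump_factor :: "nat \<Rightarrow> real" where
  "bump_factor j = 1 + (\<Sum>k<j. bump k j)"

lemma bump_nonneg: "bump k j \<ge> 0"
  by (simp add: bump_def)

lemma bump_zero: "j \<le> 16 ^ k \<Longrightarrow> bump k j = 0"
proof -
  assume "j \<le> 16 ^ k"
  then have "real j \<le> 16 ^ k" by (metis of_nat_le_iff of_nat_numeral of_nat_power)
  moreover have "(4 ^ k :: real) \<le> 16 ^ k" by (intro power_mono) auto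
  ultimately have "4 ^ k - \<bar>real j - 2 * 16 ^ k\<bar> \<le> 0" by linarith
  then show ?thesis by (simp add: bump_def)
qed

lemma less_16_power: "k < 16 ^ k"
proof -
  have "k < 2 ^ k" by (rule less_exp)
  also have "(2 ^ k :: nat) \<le> 16 ^ k" by (rule power_mono) auto
  finally show ?thesis .
qed

lemma bump_factor_eq: "j \<le> N \<Longrightarrow> bump_factor j = 1 + (\<Sum>k<N. bump k j)"
proof -
  assume "j \<le> N"
  moreover have "bump k j = 0" if "k \<ge> j" for k
  proof (rule bump_zero)
    have "k < 16 ^ k" by (rule less_16_power)
    with that show "j \<le> 16 ^ k" by simp
  qed
  ultimately have "(\<Sum>k<j. bump k j) = (\<Sum>k<N. bump k j)"
    by (intro sum.mono_neutral_left) auto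
  then show ?thesis by (simp add: bump_factor_def)
qed

lemma bump_factor_ge_1: "bump_factor j \<ge> 1"
  by (simp add: bump_factor_def sum_nonneg bump_nonneg)

lemma sum_half_powers_le: "(\<Sum>k<N. 1 / 2 ^ k :: real) \<le> 2"
  using sum_gp_strict[of "1 / 2 :: real" N] by (simp add: power_one_over)

lemma bump_factor_lipschitz: "\<bar>bump_factor (j + l) - bump_factor j\<bar> \<le> 2 * real l"
proof -
  have "\<bar>bump_factor (j + l) - bump_factor j\<bar> = \<bar>\<Sum>k<j + l. bump k (j + l) - bump k j\<bar>"
    by (simp add: bump_factor_eq[of _ "j + l"] sum_subtractf)
  also have "\<dots> \<le> (\<Sum>k<j + l. \<bar>bump k (j + l) - bump k j\<bar>)" by (rule sum_abs)
  also have "\<dots> \<le> (\<Sum>k<j + l. real l * (1 / 2 ^ k))"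
  proof (rule sum_mono)
    fix k
    have "\<bar>bump k (j + l) - bump k j\<bar> =
       \<bar>max 0 (4 ^ k - \<bar>real (j + l) - 2 * 16 ^ k\<bar>) - max 0 (4 ^ k - \<bar>real j - 2 * 16 ^ k\<bar>)\<bar> / 2 ^ k"
      by (simp add: bump_def flip: diff_divide_distrib)
    also have "\<dots> \<le> real l / 2 ^ k" by (intro divide_right_mono) (auto simp: max_def abs_if)
    finally show "\<bar>bump k (j + l) - bump k j\<bar> \<le> real l * (1 / 2 ^ k)" by simp
  qed
  also have "\<dots> \<le> 2 * real l"
    unfolding sum_distrib_left[symmetric] using mult_left_mono[OF sum_half_powers_le[of "j + l"], of "real l"]
    by (simp add: mult.commute)
  finally show ?thesis .
qed

lemma bump_factor_unbounded: "bump_factor (2 * 16 ^ k) \<ge> 2 ^ k"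
proof -
  have "bump k (2 * 16 ^ k) = 2 ^ k"
    by (simp add: bump_def power_divide[symmetric])
  moreover have "k < 2 * 16 ^ k"
    using less_16_power[of k] by simp
  then have "bump k (2 * 16 ^ k) \<le> (\<Sum>k'<2 * 16 ^ k. bump k' (2 * 16 ^ k))"
    by (intro member_le_sum) (auto simp: bump_nonneg)
  ultimately show ?thesis by (simp add: bump_factor_def)
qed

text \<open>A bump vanishes up to \<open>16 ^ k\<close>. Beyond that, \<open>N\<close> exceeds \<open>16 ^ k\<close>, and the whole sum over the bump
  is at most its height \<open>2 ^ k\<close> times its width \<open>2 * 4 ^ k\<close>.\<close>

lemma sum_bump_le: "(\<Sum>i<N. bump k i) \<le> 2 * real N * (1 / 2 ^ k)"
proof (cases "N \<le> 16 ^ k")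
  case True
  then have "(\<Sum>i<N. bump k i) = 0" by (intro sum.neutral) (auto intro: bump_zero)
  then show ?thesis by simp
next
  case False
  define S where "S = {2 * 16 ^ k - 4 ^ k..<2 * 16 ^ k + 4 ^ k :: nat}"
  have le: "(4 ^ k :: nat) \<le> 2 * 16 ^ k" using power_mono[of "4::nat" 16 k] by simp
  have "(\<Sum>i<N. bump k i) \<le> (\<Sum>i<N. if i \<in> S then 2 ^ k else 0)"
  proof (rule sum_mono)
    fix i
    have "bump k i \<le> 4 ^ k / 2 ^ k" by (simp add: bump_def divide_right_mono)
    also have "\<dots> = (2 ^ k :: real)" by (simp add: power_divide[symmetric])
    finally have "bump k i \<le> 2 ^ k" .
    moreover have "bump k i = 0" if "i \<notin> S"
    proof -
      from that have "i + 4 ^ k < 2 * 16 ^ k \<or> i \<ge> 2 * 16 ^ k + 4 ^ k" by (auto simp: S_def)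
      then have "real (i + 4 ^ k) \<le> real (2 * 16 ^ k) \<or> real i \<ge> real (2 * 16 ^ k + 4 ^ k)"
        by (auto simp only: of_nat_le_iff)
      then show ?thesis by (auto simp: bump_def)
    qed
    ultimately show "bump k i \<le> (if i \<in> S then 2 ^ k else 0)" by simp
  qed
  also have "\<dots> = 2 ^ k * real (card ({..<N} \<inter> S))"
    by (simp add: sum.If_cases)
  also have "\<dots> \<le> 2 ^ k * real (card S)"
    by (intro mult_left_mono of_nat_mono card_mono) (auto simp: S_def)
  also have "card S = 2 * 4 ^ k" using le by (simp add: S_def)
  also have "2 ^ k * real (2 * 4 ^ k) = 2 * 16 ^ k * (1 / 2 ^ k)"
  proof -
    have "(2::real) ^ k * 4 ^ k * 2 ^ k = 16 ^ k" by (simp flip: power_mult_distrib)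
    then show ?thesis by (simp add: field_simps)
  qed
  also have "\<dots> \<le> 2 * real N * (1 / 2 ^ k)"
  proof -
    have "real (16 ^ k) \<le> real N" using False by (simp only: of_nat_le_iff)
    then show ?thesis by (intro mult_right_mono) auto
  qed
  finally show ?thesis .
qed

lemma sum_bump_factor_le: "(\<Sum>i<N. bump_factor i) \<le> 5 * real N"
proof -
  have "(\<Sum>i<N. bump_factor i) = (\<Sum>i<N. 1 + (\<Sum>k<N. bump k i))"
    by (intro sum.cong refl bump_factor_eq) auto
  also have "\<dots> = real N + (\<Sum>k<N. \<Sum>i<N. bump k i)"
    unfolding sum.distrib by (subst sum.swap) simp
  also have "\<dots> \<le> real N + (\<Sum>k<N. 2 * real N * (1 / 2 ^ k))"
    by (intro add_left_mono sum_mono sum_bump_le)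
  also have "\<dots> \<le> real N + 2 * real N * 2"
    unfolding sum_distrib_left[symmetric] by (intro add_left_mono mult_left_mono sum_half_powers_le) auto
  finally show ?thesis by simp
qed

text \<open>The extra summand at 0 makes the sequence decrease from 0 to 1, which destroys
  contractivity of the shift, and affects the other properties only by constants.\<close>

definition bumped_coeff :: "nat \<Rightarrow> nat \<Rightarrow> real" where
  "bumped_coeff n j = bump_factor j * kernel_coeff n j + (if j = 0 then real n else 0)"

context
  fixes n :: nat
  assumes n: "n \<ge> 1"
begin

lemma kernel_coeff_le_bumped_coeff: "kernel_coeff n j \<le> bumped_coeff n j"
  using mult_right_mono[OF bump_factor_ge_1[of j], of "kernel_coeff n j"] kernel_coeff_pos[OF n, of j]
  by (auto simp: bumped_coeff_def bump_factor_def[of 0])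

lemma bumped_coeff_pos: "bumped_coeff n j > 0"
  using kernel_coeff_le_bumped_coeff[of j] kernel_coeff_pos[OF n, of j] by linarith

lemma bumped_coeff_0_1: "bumped_coeff n 0 = real n + 1" "bumped_coeff n 1 = real n"
proof -
  show "bumped_coeff n 0 = real n + 1" by (simp add: bumped_coeff_def bump_factor_def)
  have "bump 0 1 = 0" by (simp add: bump_def)
  then show "bumped_coeff n 1 = real n" by (simp add: bumped_coeff_def bump_factor_def kernel_coeff_def)
qed

lemma bumped_coeff_le_Suc: "bumped_coeff n j \<le> 4 * bumped_coeff n (Suc j)"
proof -
  have "bump_factor j \<le> 3 * bump_factor (Suc j)"
    using bump_factor_lipschitz[of j 1] bump_factor_ge_1[of "Suc j"] by simp
  then have "bump_factor j * kernel_coeff n j \<le> 3 * bump_factor (Suc j) * kernel_coeff n (Suc j)"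
    using kernel_coeff_le_Suc[OF n, of j] kernel_coeff_pos[OF n, of j] bump_factor_ge_1[of "Suc j"]
    by (intro mult_mono) auto
  then have "bump_factor j * kernel_coeff n j \<le> 3 * bumped_coeff n (Suc j)" by (simp add: bumped_coeff_def)
  moreover have "(if j = 0 then real n else 0) \<le> bumped_coeff n (Suc j)"
    using bumped_coeff_0_1(2) bumped_coeff_pos[of "Suc j"] by auto
  ultimately show ?thesis by (simp add: bumped_coeff_def[of n j])
qed

text \<open>As \<open>bump_factor\<close> is at least 1 and Lipschitz, it grows at most linearly relative to its value at any
  starting point.\<close>

lemma bumped_coeff_growth: "bumped_coeff n (j + l) \<le> 2 * (real l + 1) ^ (n + 1) * bumped_coeff n j"
proof (cases "l = 0")
  case True
  then show ?thesis using bumped_coeff_pos[of j] by simp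
next
  case False
  have "real l * 1 \<le> real l * bump_factor j" using bump_factor_ge_1[of j] by (intro mult_left_mono) auto
  then have "bump_factor (j + l) \<le> 2 * (real l + 1) * bump_factor j"
    using bump_factor_lipschitz[of j l] bump_factor_ge_1[of j] by (simp add: algebra_simps)
  then have "bump_factor (j + l) * kernel_coeff n (j + l) \<le> 2 * (real l + 1) * bump_factor j * ((real l + 1) ^ n * kernel_coeff n j)"
    using kernel_coeff_growth[OF n, of j l] kernel_coeff_pos[OF n, of "j + l"] bump_factor_ge_1[of j]
    by (intro mult_mono) auto
  also have "\<dots> = 2 * (real l + 1) ^ (n + 1) * (bump_factor j * kernel_coeff n j)" by simp
  also have "\<dots> \<le> 2 * (real l + 1) ^ (n + 1) * bumped_coeff n j"
    by (intro mult_left_mono) (auto simp: bumped_coeff_def)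
  finally show ?thesis using False by (simp add: bumped_coeff_def[of n "j + l"])
qed

text \<open>Monotonicity of \<open>kernel_coeff\<close> replaces all its values by the last one, which costs only the factor
  \<open>n\<close> and reduces the claim to the averages of \<open>bump_factor\<close>.\<close>

lemma sum_bumped_coeff_le: "(\<Sum>i<N. bumped_coeff n i) \<le> 6 * real n * (\<Sum>i<N. kernel_coeff n i)"
proof (cases "N = 0")
  case False
  have "(\<Sum>i<N. bump_factor i * kernel_coeff n i) \<le> (\<Sum>i<N. bump_factor i * kernel_coeff n (N - 1))"
    using bump_factor_ge_1 by (intro sum_mono mult_left_mono kernel_coeff_mono[OF n]) (auto intro: order_trans[OF zero_le_one])
  also have "\<dots> \<le> 5 * real N * kernel_coeff n (N - 1)"
    unfolding sum_distrib_right[symmetric] using kernel_coeff_pos[OF n]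
    by (intro mult_right_mono sum_bump_factor_le) (simp add: less_imp_le)
  also have "\<dots> \<le> 5 * (real n * (\<Sum>i<N. kernel_coeff n i))"
    using kernel_coeff_last_le_sum[OF n, of N] by simp
  finally have "(\<Sum>i<N. bump_factor i * kernel_coeff n i) \<le> 5 * (real n * (\<Sum>i<N. kernel_coeff n i))" .
  moreover have "(\<Sum>i<N. if i = 0 then real n else 0) \<le> real n * (\<Sum>i<N. kernel_coeff n i)"
  proof -
    have "kernel_coeff n 0 \<le> (\<Sum>i<N. kernel_coeff n i)"
      using False kernel_coeff_pos[OF n] by (intro member_le_sum) (auto simp: less_imp_le)
    then show ?thesis using False mult_left_mono[of 1 _ "real n"] by simp
  qed
  ultimately show ?thesis by (simp add: bumped_coeff_def sum.distrib)
qed simp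

lemma tame_weight_b: "tame_weight (\<lambda>j. 1 / bumped_coeff n j) 4 2 1 (n + 1)"
proof
  fix j l
  show "1 / bumped_coeff n j > 0" using bumped_coeff_pos by simp
  show "1 / bumped_coeff n (Suc j) \<le> 4 * (1 / bumped_coeff n j)"
    using bumped_coeff_le_Suc[of j] bumped_coeff_pos[of j] bumped_coeff_pos[of "Suc j"] by (simp add: field_simps)
  show "1 / bumped_coeff n j \<le> 1"
    using kernel_coeff_le_bumped_coeff[of j] kernel_coeff_ge_1[OF n, of j] by (simp add: divide_le_eq)
  show "1 / bumped_coeff n j \<le> 2 * (real l + 1) ^ (n + 1) * (1 / bumped_coeff n (j + l))"
    using bumped_coeff_growth[of j l] bumped_coeff_pos[of j] bumped_coeff_pos[of "j + l"] by (simp add: field_simps)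
qed

end

section \<open>The weighted shift with bumps\<close>

theorem corollary1p8:
  fixes n :: nat
  assumes "n \<ge> 1"
  shows "\<exists>(w :: nat \<Rightarrow> real) (\<psi> :: complex \<Rightarrow> real).
           admissible_weight w \<and>
           cowen_douglas_B1 (H2 w) (backward_shift w) \<and>
           \<not> n_hypercontraction n (H2 w) (backward_shift w) \<and>
           (\<forall>z\<in>ball 0 1. \<psi> z > 0) \<and>
           bounded (\<psi> ` ball 0 1) \<and>
           real_analytic_on \<psi> (ball 0 1) \<and>
           (\<forall>z\<in>ball 0 1.
              ddbar \<psi> z = curvature (M_space n) (S_adj n) z - curvature (H2 w) (backward_shift w) z) \<and>
           \<not> similar_ops (H2 w) (backward_shift w) (M_space n) (S_adj n)"
proof -
  define w where "w j = 1 / bumped_coeff n j" for j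
  have S_adj: "S_adj n = backward_shift (M_weight n)"
    by (simp add: S_adj_def backward_shift_def M_space_def)
  interpret T: tame_weight w 4 2 1 "n + 1"
    unfolding w_def[abs_def] by (rule tame_weight_b[OF assms])
  interpret M: tame_weight "M_weight n" 1 1 1 n by (rule tame_weight_M[OF assms])
  have inv: "1 / w j = bumped_coeff n j" "1 / M_weight n j = kernel_coeff n j" for j
    by (simp_all add: w_def M_weight_eq)
  define A where "A x = (\<Sum>j. 1 / w j * x ^ j)" for x :: real
  define B where "B x = (\<Sum>j. 1 / M_weight n j * x ^ j)" for x :: real
  define \<psi> where "\<psi> u = ln (A ((cmod u)\<^sup>2)) - ln (B ((cmod u)\<^sup>2)) + 1" for u
  have nonneg: "1 / w j \<ge> 0" "1 / M_weight n j \<ge> 0" for j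
    using T.pos[of j] M.pos[of j] by auto
  have first: "1 / w 0 > 0" "1 / M_weight n 0 > 0" using T.pos[of 0] M.pos[of 0] by auto
  have bounds: "0 < B x" "B x \<le> A x" "A x \<le> 6 * real n * B x" if "0 \<le> x" "x < 1" for x
  proof -
    note sA = T.summable_power_div_weight(1)[of x] and sB = M.summable_power_div_weight(1)[of x]
    have "(\<Sum>j<1. 1 / M_weight n j * x ^ j) \<le> B x"
      unfolding B_def by (rule sum_le_suminf) (use that nonneg sB in auto)
    then have "1 / M_weight n 0 \<le> B x" by simp
    with first(2) show "0 < B x" by linarith
    show "B x \<le> A x"
      unfolding A_def B_def
      by (rule suminf_le) (use that sA sB in \<open>auto simp: inv intro!: mult_right_mono kernel_coeff_le_bumped_coeff[OF assms]\<close>)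
    have "A x \<le> (\<Sum>j. (6 * real n * kernel_coeff n j) * x ^ j)"
      unfolding A_def inv
    proof (rule power_series_le_of_partial_sums_le)
      show "(\<Sum>i<N. bumped_coeff n i) \<le> (\<Sum>i<N. 6 * real n * kernel_coeff n i)" for N
        using sum_bumped_coeff_le[OF assms, of N] by (simp add: sum_distrib_left)
      show "summable (\<lambda>i. bumped_coeff n i * x ^ i)" using sA that by (simp add: inv)
      show "summable (\<lambda>i. 6 * real n * kernel_coeff n i * x ^ i)"
        unfolding mult.assoc[of _ "kernel_coeff n _"] using sB that by (intro summable_mult) (simp add: inv)
    qed (use that in auto)
    also have "\<dots> = 6 * real n * B x"
      using suminf_mult[of "\<lambda>j. kernel_coeff n j * x ^ j" "6 * real n"] sB that
      by (simp add: B_def inv mult.assoc)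
    finally show "A x \<le> 6 * real n * B x" .
  qed
  have \<psi>: "\<psi> u \<ge> 1" "\<psi> u \<le> ln (6 * real n) + 1" if "u \<in> ball 0 1" for u
  proof -
    have x: "0 \<le> (cmod u)\<^sup>2" "(cmod u)\<^sup>2 < 1" using that by (auto simp: power_less_one_iff)
    note * = bounds[OF x]
    show "\<psi> u \<ge> 1" using * by (simp add: \<psi>_def)
    have "ln (A ((cmod u)\<^sup>2)) \<le> ln (6 * real n * B ((cmod u)\<^sup>2))" using * by simp
    also have "\<dots> = ln (6 * real n) + ln (B ((cmod u)\<^sup>2))"
      using * assms by (simp add: ln_mult)
    finally show "\<psi> u \<le> ln (6 * real n) + 1" by (simp add: \<psi>_def)
  qed
  have "\<forall>z\<in>ball 0 1. \<psi> z > 0" using \<psi>(1) by (auto intro: less_le_trans[OF zero_less_one])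
  moreover have "bounded (\<psi> ` ball 0 1)"
    unfolding bounded_real using \<psi> by (intro exI[of _ "ln (6 * real n) + 1"]) fastforce
  moreover have "real_analytic_on \<psi> (ball 0 1)"
    unfolding \<psi>_def A_def B_def
    by (rule real_analytic_on_ln_power_series_diff[OF nonneg(1) first(1) nonneg(2) first(2)
          T.summable_power_div_weight(2) M.summable_power_div_weight(2)])
  moreover have "\<forall>z\<in>ball 0 1.
      ddbar \<psi> z = curvature (M_space n) (S_adj n) z - curvature (H2 w) (backward_shift w) z"
  proof
    fix z :: complex assume z: "z \<in> ball 0 1"
    obtain \<alpha>' \<alpha>'' where \<alpha>:
      "\<And>x. 0 \<le> x \<Longrightarrow> x < 1 \<Longrightarrow> ((\<lambda>x. ln (\<Sum>j. 1 / w j * x ^ j)) has_real_derivative \<alpha>' x) (at x)"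
      "\<And>x. 0 \<le> x \<Longrightarrow> x < 1 \<Longrightarrow> (\<alpha>' has_real_derivative \<alpha>'' x) (at x)"
      by (rule ln_power_series_derivatives[OF nonneg(1) first(1) T.summable_power_div_weight(1)], assumption, rule that)
    obtain \<beta>' \<beta>'' where \<beta>:
      "\<And>x. 0 \<le> x \<Longrightarrow> x < 1 \<Longrightarrow>
         ((\<lambda>x. ln (\<Sum>j. 1 / M_weight n j * x ^ j)) has_real_derivative \<beta>' x) (at x)"
      "\<And>x. 0 \<le> x \<Longrightarrow> x < 1 \<Longrightarrow> (\<beta>' has_real_derivative \<beta>'' x) (at x)"
      by (rule ln_power_series_derivatives[OF nonneg(2) first(2) M.summable_power_div_weight(1)], assumption, rule that)
    have "ddbar \<psi> z = complex_of_real ((\<alpha>' ((cmod z)\<^sup>2) - \<beta>' ((cmod z)\<^sup>2))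
        + (cmod z)\<^sup>2 * (\<alpha>'' ((cmod z)\<^sup>2) - \<beta>'' ((cmod z)\<^sup>2)))"
    proof (rule ddbar_harmonic_plus_radial[where g = "\<lambda>_. 1 / 2"
          and \<phi> = "\<lambda>x. ln (A x) - ln (B x)" and \<phi>' = "\<lambda>x. \<alpha>' x - \<beta>' x"])
      show "((\<lambda>x. ln (A x) - ln (B x)) has_real_derivative \<alpha>' x - \<beta>' x) (at x)"
        if "0 \<le> x" "x < 1" for x
        unfolding A_def B_def by (intro DERIV_diff \<alpha>(1) \<beta>(1) that)
      show "((\<lambda>x. \<alpha>' x - \<beta>' x) has_real_derivative \<alpha>'' x - \<beta>'' x) (at x)" if "0 \<le> x" "x < 1" for x
        by (intro DERIV_diff \<alpha>(2) \<beta>(2) that)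
    qed (use z in \<open>auto simp: \<psi>_def\<close>)
    then show "ddbar \<psi> z = curvature (M_space n) (S_adj n) z - curvature (H2 w) (backward_shift w) z"
      by (simp add: S_adj M_space_def T.curvature_eq[OF z \<alpha>] M.curvature_eq[OF z \<beta>] algebra_simps)
  qed
  moreover have "\<not> n_hypercontraction n (H2 w) (backward_shift w)"
  proof (rule not_hypercontraction[OF T.admissible assms])
    show "w 0 < w 1" using bumped_coeff_0_1[OF assms] assms by (simp add: w_def frac_less2)
  qed
  moreover have "\<not> similar_ops (H2 w) (backward_shift w) (M_space n) (S_adj n)"
  proof
    assume "similar_ops (H2 w) (backward_shift w) (M_space n) (S_adj n)"
    then obtain c where c: "\<And>k. M_weight n k / w k \<le> c"
      unfolding S_adj M_space_def
      by (rule similar_shifts_weight_ratio_bounded[OF T.admissible M.admissible]) (rule that)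
    obtain k where k: "c < 2 ^ k" using real_arch_pow[of 2 c] by auto
    have "M_weight n j / w j = bump_factor j" if "j > 0" for j
      using kernel_coeff_pos[OF assms, of j] that by (simp add: w_def M_weight_eq bumped_coeff_def)
    then have "bump_factor (2 * 16 ^ k) \<le> c" using c[of "2 * 16 ^ k"] by simp
    with k bump_factor_unbounded[of k] show False by linarith
  qed
  ultimately show ?thesis
    using T.admissible T.cowen_douglas by blast
qed

end
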